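(* Let $\{\mathcal{T}(t)\}_{t\ge 0}$ be the symmetric telegraph process with speed $c>0$ and rate $\lambda>0$, and let $t>0$. For every integer $k\ge 1$ and $0<\beta<ct$, $$P\Bigl\{ \max_{0\le s\le t} \mathcal{T}(s) < \beta \,\Big|\, V(0) = -c,\ N(t) = 2k\Bigr\} = \frac{\beta}{ct} \sum_{j=0}^{k-1} \Bigl( \frac{c^2t^2-\beta^2}{c^2t^2}\Bigr)^j \frac{1}{2^{2j}}\binom{2j}{j} + \frac{(c^2t^2-\beta^2)^k }{(2ct)^{2k}}\binom{2k}{k} .$$
   Context: Let $c>0$, $\lambda>0$. Let $V(0)$ be a random variable with $P\{V(0)=c\}=P\{V(0)=-c\}=\tfrac12$ and let $\{N(t)\}_{t\ge0}$ be a homogeneous Poisson process with rate $\lambda$, independent of $V(0)$. The symmetric telegraph process is $\mathcal{T}(t)=\int_0^t V(0)(-1)^{N(s)}\,ds$, $t\ge 0$ (so $\mathcal{T}(0)=0$). *)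

theory Defs
  imports "HOL-Probability.Probability"
begin

text \<open>
  The time index ranges over the reals, but only times \<open>t \<ge> 0\<close> are constrained.
  The path conditions hold for every outcome rather than almost surely, since
  \<open>M\<close> need not be complete and path functionals such as a running maximum must be measurable.
  By monotonicity the truncated subtraction on \<^typ>\<open>nat\<close> gives the true increments.
\<close>

locale poisson_process = prob_space M for M :: "'a measure" +
  fixes rate :: real and N :: "real \<Rightarrow> 'a \<Rightarrow> nat"
  assumes rate_pos: "0 < rate"
    and random_variable_N:
      "\<And>t. 0 \<le> t \<Longrightarrow> random_variable (count_space UNIV) (N t)"
    and start_zero: "\<And>\<omega>. \<omega> \<in> space M \<Longrightarrow> N 0 \<omega> = 0"
    and mono_path:
      "\<And>\<omega> s t. \<omega> \<in> space M \<Longrightarrow> 0 \<le> s \<Longrightarrow> s \<le> t \<Longrightarrow> N s \<omega> \<le> N t \<omega>"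
    and right_continuous_path:
      "\<And>\<omega> t. \<omega> \<in> space M \<Longrightarrow> 0 \<le> t \<Longrightarrow> ((\<lambda>s. N s \<omega>) \<longlongrightarrow> N t \<omega>) (at_right t)"
    and increments_poisson:
      "\<And>s t. 0 \<le> s \<Longrightarrow> s < t \<Longrightarrow>
        distr M (count_space UNIV) (\<lambda>\<omega>. N t \<omega> - N s \<omega>)
          = measure_pmf (poisson_pmf (rate * (t - s)))"
    and increments_indep:
      "\<And>(\<tau> :: nat \<Rightarrow> real) n. 0 \<le> \<tau> 0 \<Longrightarrow> (\<And>i. i < n \<Longrightarrow> \<tau> i \<le> \<tau> (Suc i)) \<Longrightarrow>
        indep_vars (\<lambda>_. count_space UNIV) (\<lambda>i \<omega>. N (\<tau> (Suc i)) \<omega> - N (\<tau> i) \<omega>) {..<n}"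

text \<open>
  Independence of \<open>V0\<close> is from the whole process \<open>(N t)\<close>, \<open>t \<ge> 0\<close>,
  seen as one random element of the product space. It is stated for the generated
  sigma-algebras because \<^term>\<open>prob_space.indep_var\<close> needs both variables to have values
  in the same type.
\<close>

locale symmetric_telegraph = poisson_process M rate N
  for M :: "'a measure" and rate :: real and N :: "real \<Rightarrow> 'a \<Rightarrow> nat" +
  fixes c :: real and V0 :: "'a \<Rightarrow> real"
  assumes speed_pos: "0 < c"
    and random_variable_V0: "random_variable borel V0"
    and prob_V0_pos: "\<P>(\<omega> in M. V0 \<omega> = c) = 1 / 2"
    and prob_V0_neg: "\<P>(\<omega> in M. V0 \<omega> = - c) = 1 / 2"
    and indep_V0_N:
      "indep_set {V0 -` A \<inter> space M | A. A \<in> sets borel}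
        {(\<lambda>\<omega>. \<lambda>t\<in>{0..}. N t \<omega>) -` B \<inter> space M | B.
          B \<in> sets (PiM {0..} (\<lambda>_. count_space UNIV))}"

definition telegraph :: "('a \<Rightarrow> real) \<Rightarrow> (real \<Rightarrow> 'a \<Rightarrow> nat) \<Rightarrow> real \<Rightarrow> 'a \<Rightarrow> real" where
  "telegraph V0 N t \<omega> = integral {0..t} (\<lambda>s. V0 \<omega> * (- 1) ^ N s \<omega>)"

text \<open>
  The maximum is over an infinite set, hence a supremum; it is attained because
  the paths of \<^const>\<open>telegraph\<close> are continuous.
\<close>

definition telegraph_max :: "('a \<Rightarrow> real) \<Rightarrow> (real \<Rightarrow> 'a \<Rightarrow> nat) \<Rightarrow> real \<Rightarrow> 'a \<Rightarrow> real" where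
  "telegraph_max V0 N t \<omega> = (SUP s\<in>{0..t}. telegraph V0 N s \<omega>)"

end

theory Submission
  imports Defs
begin

text \<open>
  By scaling the speed is one. Let \<open>v_n(t, y)\<close>, with a direction up or down, be the volume of the
  set of \<open>n\<close> ordered jump times in \<open>[0, t]\<close> for which the particle starting in that direction
  stays below \<open>y\<close>. The probability of staying below \<open>y\<close> and having \<open>n\<close> jumps is
  \<open>exp (- \<lambda> t) \<lambda>^n v_n(t, y)\<close>. Conditioning on what happens in a short initial interval
  shows that, for \<open>0 < y < t\<close>, the volume of index \<open>n + 1\<close> satisfies a transport equation
  along \<open>t + y = const\<close> (start down) or \<open>t - y = const\<close> (start up) whose source is the volume of
  index \<open>n\<close> for the opposite direction. The boundary values are \<open>0\<close> at \<open>y = 0\<close> for an upward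
  start and \<open>t^n / n!\<close> at \<open>y = t\<close> for a downward start. Starting down with an even number of
  jumps involves only upward starts with an odd number and vice versa, and for these the
  equations are solved by explicit polynomials.
\<close>

subsection \<open>Measurability of path functionals\<close>

text \<open>Sampling the path at grid points of mesh \<open>1 / Suc m\<close> gives a countable
  patchwork of measurable sections, and right-continuity makes these samples converge pointwise.
  Replacing \<open>r\<close> by \<open>max s r\<close> yields a function on the whole line from
  assumptions about times after \<open>s\<close> only.\<close>

lemma right_continuous_jointly_measurable:
  fixes X :: "real \<Rightarrow> 'a \<Rightarrow> real"
  assumes meas: "\<And>u. s \<le> u \<Longrightarrow> X u \<in> borel_measurable M"
    and right: "\<And>\<omega> u. \<omega> \<in> space M \<Longrightarrow> s \<le> u \<Longrightarrow> ((\<lambda>r. X r \<omega>) \<longlongrightarrow> X u \<omega>) (at_right u)"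
  shows "(\<lambda>(\<omega>, r). X (max s r) \<omega>) \<in> borel_measurable (M \<Otimes>\<^sub>M lborel)"
proof (rule borel_measurable_LIMSEQ_real)
  let ?i = "\<lambda>m r. nat \<lfloor>(max s r - s) * real (Suc m)\<rfloor>"
  \<comment> \<open>The next grid point strictly after \<open>max s r\<close>; strictness is what
    allows the limit along \<open>at_right\<close>.\<close>
  let ?g = "\<lambda>m r. s + (real (?i m r) + 1) / real (Suc m)"
  fix x :: "'a \<times> real" assume "x \<in> space (M \<Otimes>\<^sub>M lborel)"
  then obtain \<omega> r where x: "x = (\<omega>, r)" and \<omega>: "\<omega> \<in> space M"
    by (auto simp: space_pair_measure)
  let ?r = "max s r"
  have i_eq: "real (?i m r) = of_int \<lfloor>(?r - s) * real (Suc m)\<rfloor>" for m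
  proof -
    have "0 \<le> \<lfloor>(?r - s) * real (Suc m)\<rfloor>"
      by (subst zero_le_floor) (intro mult_nonneg_nonneg, auto)
    then show ?thesis by simp
  qed
  have gt: "?r < ?g m r" for m
  proof -
    have "(?r - s) * real (Suc m) < real (?i m r) + 1"
      unfolding i_eq by linarith
    then have "?r - s < (real (?i m r) + 1) / real (Suc m)"
      by (subst pos_less_divide_eq) auto
    then show ?thesis by linarith
  qed
  have le: "?g m r \<le> ?r + 1 / real (Suc m)" for m
  proof -
    have "real (?i m r) \<le> (?r - s) * real (Suc m)"
      unfolding i_eq by linarith
    then have "real (?i m r) / real (Suc m) \<le> ?r - s"
      by (subst pos_divide_le_eq) auto
    then show ?thesis by (simp add: add_divide_distrib)
  qed
  have "(\<lambda>m. ?r + 1 / real (Suc m)) \<longlonglongrightarrow> ?r + 0"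
    by (intro tendsto_intros) (rule LIMSEQ_Suc[OF lim_1_over_n])
  then have "(\<lambda>m. ?g m r) \<longlonglongrightarrow> ?r"
    using gt le
    by (intro tendsto_sandwich[of "\<lambda>_. ?r" "\<lambda>m. ?g m r" sequentially "\<lambda>m. ?r + 1 / real (Suc m)" "?r"])
      (auto intro!: always_eventually less_imp_le)
  then have lim: "filterlim (\<lambda>m. ?g m r) (at_right ?r) sequentially"
    using gt unfolding filterlim_at by (auto intro!: always_eventually simp: less_imp_neq[symmetric])
  have "(\<lambda>m. X (?g m r) \<omega>) \<longlonglongrightarrow> X ?r \<omega>"
    by (rule filterlim_compose[OF right[OF \<omega>] lim]) simp
  then show "(\<lambda>m. (\<lambda>(\<omega>, r). X (?g m r) \<omega>) x) \<longlonglongrightarrow> (\<lambda>(\<omega>, r). X (max s r) \<omega>) x"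
    by (simp add: x)
next
  fix m
  let ?i = "\<lambda>r. nat \<lfloor>(max s r - s) * real (Suc m)\<rfloor>"
  have X: "X (s + (real i + 1) / real (Suc m)) \<in> borel_measurable M" for i
    by (rule meas) auto
  have "(\<lambda>x. X (s + (real (?i (snd x)) + 1) / real (Suc m)) (fst x)) \<in> borel_measurable (M \<Otimes>\<^sub>M lborel)"
  proof (rule measurable_compose_countable[where g="\<lambda>x. ?i (snd x)"
        and f="\<lambda>i x. X (s + (real i + 1) / real (Suc m)) (fst x)"])
    show "(\<lambda>x. X (s + (real i + 1) / real (Suc m)) (fst x)) \<in> borel_measurable (M \<Otimes>\<^sub>M lborel)" for i
      using measurable_compose[OF measurable_fst X] by simp
  qed measurable
  then show "(\<lambda>(\<omega>, r). X (s + (real (?i r) + 1) / real (Suc m)) \<omega>) \<in> borel_measurable (M \<Otimes>\<^sub>M lborel)"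
    by (simp add: case_prod_unfold)
qed

text \<open>Joint measurability and the bound make every section Lebesgue integrable on
  \<open>{s..t}\<close>, and integrating out the time keeps measurability in the outcome. The
  Lebesgue integral then agrees with the gauge integral \<open>integral\<close>.\<close>

lemma integral_right_continuous_measurable:
  fixes X :: "real \<Rightarrow> 'a \<Rightarrow> real"
  assumes meas: "\<And>u. s \<le> u \<Longrightarrow> X u \<in> borel_measurable M"
    and right: "\<And>\<omega> u. \<omega> \<in> space M \<Longrightarrow> s \<le> u \<Longrightarrow> ((\<lambda>r. X r \<omega>) \<longlongrightarrow> X u \<omega>) (at_right u)"
    and bound: "\<And>\<omega> u. \<omega> \<in> space M \<Longrightarrow> s \<le> u \<Longrightarrow> \<bar>X u \<omega>\<bar> \<le> B"
  shows "\<omega> \<in> space M \<Longrightarrow> (\<lambda>r. X r \<omega>) integrable_on {s..t}"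
    and "(\<lambda>\<omega>. integral {s..t} (\<lambda>r. X r \<omega>)) \<in> borel_measurable M"
proof -
  note joint = right_continuous_jointly_measurable[of s X M, OF meas right]
  have int: "set_integrable lborel {s..t} (\<lambda>r. X r \<omega>)" if \<omega>: "\<omega> \<in> space M" for \<omega>
  proof -
    have sec: "(\<lambda>r. X (max s r) \<omega>) \<in> borel_measurable lborel"
      using measurable_compose[OF measurable_Pair1'[OF \<omega>] joint] by simp
    have "integrable lborel (\<lambda>r. indicator {s..t} r *\<^sub>R X (max s r) \<omega>)"
    proof (rule Bochner_Integration.integrable_bound)
      show "integrable lborel (\<lambda>r. indicator {s..t} r *\<^sub>R B)"
        using borel_integrable_atLeastAtMost'[of s t "\<lambda>_. B"] by (simp add: set_integrable_def)
      show "(\<lambda>r. indicator {s..t} r *\<^sub>R X (max s r) \<omega>) \<in> borel_measurable lborel"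
        using sec by measurable
      show "AE r in lborel. norm (indicator {s..t} r *\<^sub>R X (max s r) \<omega>) \<le> norm (indicator {s..t} r *\<^sub>R B)"
        using bound[OF \<omega>] by (intro AE_I2) (force simp: indicator_def)
    qed
    also have "(\<lambda>r. indicator {s..t} r *\<^sub>R X (max s r) \<omega>) = (\<lambda>r. indicator {s..t} r *\<^sub>R X r \<omega>)"
      by (auto simp: indicator_def max_def fun_eq_iff)
    finally show ?thesis by (simp add: set_integrable_def)
  qed
  show "\<omega> \<in> space M \<Longrightarrow> (\<lambda>r. X r \<omega>) integrable_on {s..t}"
    using set_borel_integral_eq_integral(1)[OF int] .
  have "(\<lambda>\<omega>. LINT r|lborel. indicator {s..t} r *\<^sub>R X (max s r) \<omega>) \<in> borel_measurable M"
    using joint by measurable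
  then show "(\<lambda>\<omega>. integral {s..t} (\<lambda>r. X r \<omega>)) \<in> borel_measurable M"
  proof (rule measurable_cong[THEN iffD1, rotated])
    fix \<omega> assume \<omega>: "\<omega> \<in> space M"
    have "(\<lambda>r. indicator {s..t} r *\<^sub>R X (max s r) \<omega>) = (\<lambda>r. indicator {s..t} r *\<^sub>R X r \<omega>)"
      by (auto simp: indicator_def max_def fun_eq_iff)
    then show "(LINT r|lborel. indicator {s..t} r *\<^sub>R X (max s r) \<omega>) = integral {s..t} (\<lambda>r. X r \<omega>)"
      using set_borel_integral_eq_integral(2)[OF int[OF \<omega>]] by (simp add: set_lebesgue_integral_def)
  qed
qed

text \<open>The uncountable quantifier is reduced to a countable dense set. A strict inequality does
  not pass to the closure, but by compactness the maximum is attained, so the inequality holds with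
  some margin \<open>1 / Suc m\<close>, and the resulting weak inequality does pass.\<close>

lemma sets_Collect_continuous_less:
  fixes f :: "real \<Rightarrow> 'a \<Rightarrow> real"
  assumes meas: "\<And>u. u \<in> {s..t} \<Longrightarrow> f u \<in> borel_measurable M"
    and cont: "\<And>\<omega>. \<omega> \<in> space M \<Longrightarrow> continuous_on {s..t} (\<lambda>u. f u \<omega>)"
  shows "{\<omega> \<in> space M. \<forall>u\<in>{s..t}. f u \<omega> < y} \<in> sets M"
proof -
  obtain D where D: "countable D" "D \<subseteq> {s..t}" "{s..t} \<subseteq> closure D"
    using separable by metis
  have clo: "closure D = {s..t}"
    using D closure_minimal[of D "{s..t}"] by auto
  have "{\<omega> \<in> space M. \<forall>u\<in>{s..t}. f u \<omega> < y} =
      {\<omega> \<in> space M. \<exists>m::nat. \<forall>u\<in>D. f u \<omega> \<le> y - 1 / real (Suc m)}" (is "?L = ?R")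
  proof (intro set_eqI iffI)
    fix \<omega> assume "\<omega> \<in> ?L"
    then have \<omega>: "\<omega> \<in> space M" and less: "\<And>u. u \<in> {s..t} \<Longrightarrow> f u \<omega> < y" by auto
    have "\<exists>m::nat. \<forall>u\<in>D. f u \<omega> \<le> y - 1 / real (Suc m)"
    proof (cases "s \<le> t")
      case True
      then obtain x where x: "x \<in> {s..t}" "\<And>u. u \<in> {s..t} \<Longrightarrow> f u \<omega> \<le> f x \<omega>"
        using continuous_attains_sup[OF _ _ cont[OF \<omega>]] by auto
      obtain m where m: "1 / real (Suc m) < y - f x \<omega>"
        using less[OF x(1)] nat_approx_posE[of "y - f x \<omega>"] by auto
      have "f u \<omega> \<le> y - 1 / real (Suc m)" if "u \<in> D" for u
      proof -
        have "f u \<omega> \<le> f x \<omega>" using x(2) D(2) that by auto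
        then show ?thesis using m by linarith
      qed
      then show ?thesis by blast
    qed (use D in auto)
    then show "\<omega> \<in> ?R" using \<omega> by auto
  next
    fix \<omega> assume "\<omega> \<in> ?R"
    then obtain m where \<omega>: "\<omega> \<in> space M" and m: "\<And>u. u \<in> D \<Longrightarrow> f u \<omega> \<le> y - 1 / real (Suc m)" by auto
    have "f u \<omega> < y" if "u \<in> {s..t}" for u
    proof -
      have "f u \<omega> \<le> y - 1 / real (Suc m)"
        using continuous_le_on_closure[of D "\<lambda>u. f u \<omega>" u "y - 1 / real (Suc m)"] cont[OF \<omega>] m that
        unfolding clo by blast
      moreover have "1 / real (Suc m) > 0" by simp
      ultimately show ?thesis by linarith
    qed
    then show "\<omega> \<in> ?L" using \<omega> by auto
  qed
  also have "\<dots> \<in> sets M"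
  proof (rule sets.sets_Collect_countable_Ex)
    fix m :: nat
    have "{\<omega> \<in> space M. \<forall>u\<in>D. f u \<omega> \<le> y - 1 / real (Suc m)} = 
      space M \<inter> (\<Inter>u\<in>D. {\<omega> \<in> space M. f u \<omega> \<le> y - 1 / real (Suc m)})" by auto
    also have "\<dots> \<in> sets M"
    proof (cases "D = {}")
      case False
      then show ?thesis
        using D meas by (intro sets.Int sets.countable_INT') (auto simp: subset_iff)
    qed auto
    finally show "{\<omega> \<in> space M. \<forall>u\<in>D. f u \<omega> \<le> y - 1 / real (Suc m)} \<in> sets M" .
  qed
  finally show ?thesis .
qed

subsection \<open>Displacement along a counting path\<close>

definition jump_path :: "(real \<Rightarrow> nat) \<Rightarrow> bool" where
  "jump_path p \<longleftrightarrow> (\<forall>s t. 0 \<le> s \<longrightarrow> s \<le> t \<longrightarrow> p s \<le> p t) \<and> (\<forall>t\<ge>0. (p \<longlongrightarrow> p t) (at_right t))"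

text \<open>
  The position at time \<open>u\<close> of a particle of unit speed that starts at the origin at time \<open>s\<close>
  in the positive direction and turns at the jumps of \<open>p\<close>.
\<close>

definition displacement :: "(real \<Rightarrow> nat) \<Rightarrow> real \<Rightarrow> real \<Rightarrow> real" where
  "displacement p s u = (- 1) ^ p s * integral {s..u} (\<lambda>r. (- 1) ^ p r)"

context
  fixes p :: "real \<Rightarrow> nat"
  assumes p: "jump_path p"
begin

lemma jump_path_mono: "0 \<le> s \<Longrightarrow> s \<le> t \<Longrightarrow> p s \<le> p t"
  using p by (auto simp: jump_path_def)

lemma jump_path_sign_right_continuous:
  assumes "0 \<le> u"
  shows "((\<lambda>r. (- 1 :: real) ^ p r) \<longlongrightarrow> (- 1) ^ p u) (at_right u)"
proof -
  have "(p \<longlongrightarrow> p u) (at_right u)"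
    using p assms by (auto simp: jump_path_def)
  then have "\<forall>\<^sub>F r in at_right u. p r = p u"
    by (simp add: tendsto_discrete)
  then show ?thesis
    by (intro tendsto_eventually) (auto elim: eventually_mono)
qed

lemma jump_path_integrable:
  assumes "0 \<le> s"
  shows "(\<lambda>r. (- 1 :: real) ^ p r) integrable_on {s..u}"
  using assms
  \<comment> \<open>A one-point sample space turns the statement on random paths into one on a
    single path.\<close>
  by (intro integral_right_continuous_measurable(1)[where M="count_space (UNIV::unit set)"
        and X="\<lambda>r _. (- 1) ^ p r" and B=1, simplified])
    (auto simp: power_abs intro!: jump_path_sign_right_continuous)

lemma abs_displacement_le:
  assumes "0 \<le> s" "s \<le> u"
  shows "\<bar>displacement p s u\<bar> \<le> u - s"
proof -
  have "norm (integral {s..u} (\<lambda>r. (- 1 :: real) ^ p r)) \<le> integral {s..u} (\<lambda>r. 1)"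
    by (intro integral_norm_bound_integral jump_path_integrable assms) (auto simp: power_abs)
  then show ?thesis using assms by (simp add: displacement_def abs_mult power_abs)
qed

text \<open>The sign \<open>(- 1) ^ (p s + p v)\<close> is the direction at time \<open>v\<close>
  relative to that at time \<open>s\<close>.\<close>

lemma displacement_split:
  assumes "0 \<le> s" "s \<le> v" "v \<le> u"
  shows "displacement p s u = displacement p s v + (- 1) ^ (p s + p v) * displacement p v u"
proof -
  have *: "(- 1 :: real) ^ p v * ((- 1) ^ p v * x) = x" for x
    by (simp add: mult.assoc[symmetric] power_mult_distrib[symmetric])
  show ?thesis
    using Henstock_Kurzweil_Integration.integral_combine[OF assms(2,3) jump_path_integrable[OF assms(1)]]
    by (simp add: displacement_def power_add ring_distribs mult.assoc * flip: distrib_left)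
qed

lemma displacement_constant:
  assumes "0 \<le> s" "s \<le> u" "p s = p u"
  shows "displacement p s u = u - s"
proof -
  have "integral {s..u} (\<lambda>r. (- 1 :: real) ^ p r) = integral {s..u} (\<lambda>r. (- 1) ^ p s)"
    using assms by (intro Henstock_Kurzweil_Integration.integral_cong)
      (metis atLeastAtMost_iff jump_path_mono le_antisym order_trans)
  then show ?thesis
    using assms by (simp add: displacement_def mult.assoc[symmetric] power_mult_distrib[symmetric])
qed

text \<open>Strictness comes from right-continuity: the path has an initial stretch without jumps,
  on which the particle moves upwards.\<close>

lemma displacement_gt:
  assumes "0 \<le> s" "s < u"
  shows "- (u - s) < displacement p s u"
proof -
  have "(p \<longlongrightarrow> p s) (at_right s)"
    using p assms by (auto simp: jump_path_def)
  then have "\<forall>\<^sub>F r in at_right s. p r = p s"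
    by (simp add: tendsto_discrete)
  then obtain b where b: "s < b" "\<And>r. s < r \<Longrightarrow> r < b \<Longrightarrow> p r = p s"
    using assms by (auto simp: eventually_at_right[OF \<open>s < u\<close>])
  \<comment> \<open>A point strictly inside the jump-free stretch and not beyond
    \<open>u\<close>.\<close>
  define v where "v = (s + min b u) / 2"
  have v: "s < v" "v < b" "v \<le> u" using b assms by (auto simp: v_def min_def field_simps)
  have "displacement p s u = (v - s) + (- 1) ^ (p s + p v) * displacement p v u"
    using displacement_split[of s v u] displacement_constant[of s v] b(2)[of v] v assms by simp
  moreover have "\<bar>(- 1) ^ (p s + p v) * displacement p v u\<bar> \<le> u - v"
    using abs_displacement_le[of v u] v assms by (simp add: abs_mult power_abs)
  ultimately show ?thesis using v by linarith
qed

lemma continuous_on_displacement: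
  assumes "0 \<le> s"
  shows "continuous_on {s..t} (displacement p s)"
  unfolding displacement_def
  by (intro continuous_intros indefinite_integral_continuous_1 jump_path_integrable assms)

end

text \<open>
  The sign \<open>sg\<close> is the direction at time \<open>s\<close>, and \<open>y\<close> the distance to the barrier.
\<close>

definition survival :: "(real \<Rightarrow> nat) \<Rightarrow> real \<Rightarrow> real \<Rightarrow> nat \<Rightarrow> real \<Rightarrow> real \<Rightarrow> bool" where
  "survival p t sg n s y \<longleftrightarrow> (\<forall>u\<in>{s..t}. sg * displacement p s u < y) \<and> p t = p s + n"

text \<open>The cylinder sets of the increments after \<open>s\<close>. They form a generator closed
  under intersection, so that independence has to be checked only for finitely many times.\<close>

definition future_generator :: "'a measure \<Rightarrow> (real \<Rightarrow> 'a \<Rightarrow> nat) \<Rightarrow> real \<Rightarrow> 'a set set" where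
  "future_generator M N s =
    {{\<omega> \<in> space M. \<forall>u\<in>J. N u \<omega> - N s \<omega> \<in> A u} | J A. finite J \<and> J \<subseteq> {s..}}"

text \<open>The displacement from time \<open>s\<close> is the integral of
  \<open>(- 1) ^ (N u - N s)\<close>, so measurability of the increments after \<open>s\<close>
  suffices. The measure space is kept arbitrary because the lemma is also applied to smaller
  sigma-algebras: the one generated by the future increments and the one generated by the whole
  counting path.\<close>

lemma survival_sets:
  fixes N :: "real \<Rightarrow> 'a \<Rightarrow> nat"
  assumes path: "\<And>\<omega>. \<omega> \<in> space M \<Longrightarrow> jump_path (\<lambda>u. N u \<omega>)"
    and meas: "\<And>u. s \<le> u \<Longrightarrow> (\<lambda>\<omega>. N u \<omega> - N s \<omega>) \<in> measurable M (count_space UNIV)"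
    and st: "0 \<le> s" "s \<le> t"
  shows "{\<omega> \<in> space M. survival (\<lambda>u. N u \<omega>) t sg n s y} \<in> sets M"
proof -
  let ?X = "\<lambda>u \<omega>. (- 1 :: real) ^ (N u \<omega> - N s \<omega>)"
  have sign: "?X u \<omega> = (- 1) ^ N s \<omega> * (- 1) ^ N u \<omega>" if "\<omega> \<in> space M" "s \<le> u" for u \<omega>
  proof -
    have "N s \<omega> \<le> N u \<omega>" using jump_path_mono[OF path[OF that(1)]] st that by simp
    then obtain d where "N u \<omega> = N s \<omega> + d" using le_Suc_ex by blast
    then show ?thesis
      by (simp add: power_add mult.assoc[symmetric] power_mult_distrib[symmetric])
  qed
  have displacement_eq: "displacement (\<lambda>u. N u \<omega>) s u = integral {s..u} (\<lambda>r. ?X r \<omega>)" if "\<omega> \<in> space M" for u \<omega>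
  proof -
    have "integral {s..u} (\<lambda>r. ?X r \<omega>) = integral {s..u} (\<lambda>r. (- 1) ^ N s \<omega> * (- 1) ^ N r \<omega>)"
      using that by (intro Henstock_Kurzweil_Integration.integral_cong) (auto simp: sign)
    then show ?thesis by (simp add: displacement_def)
  qed
  have mX: "?X u \<in> borel_measurable M" if "s \<le> u" for u
    using measurable_compose[OF meas[OF that], of "\<lambda>d. (- 1 :: real) ^ d" borel] by simp
  have "(\<lambda>\<omega>. integral {s..u} (\<lambda>r. ?X r \<omega>)) \<in> borel_measurable M" for u
  proof (rule integral_right_continuous_measurable(2)[where B=1, OF mX])
    fix \<omega> u assume \<omega>: "\<omega> \<in> space M" and u: "s \<le> u"
    have "((\<lambda>r. (- 1) ^ N s \<omega> * (- 1 :: real) ^ N r \<omega>) \<longlongrightarrow> (- 1) ^ N s \<omega> * (- 1) ^ N u \<omega>) (at_right u)"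
      using jump_path_sign_right_continuous[OF path[OF \<omega>], of u] st u by (intro tendsto_intros) auto
    then have "((\<lambda>r. ?X r \<omega>) \<longlongrightarrow> (- 1) ^ N s \<omega> * (- 1) ^ N u \<omega>) (at_right u)"
      by (rule Lim_transform_eventually)
        (use \<omega> u in \<open>auto simp: sign eventually_at_filter intro!: always_eventually\<close>)
    then show "((\<lambda>r. ?X r \<omega>) \<longlongrightarrow> ?X u \<omega>) (at_right u)"
      using sign[OF \<omega> u] by simp
  qed (auto simp: power_abs)
  then have "(\<lambda>\<omega>. displacement (\<lambda>u. N u \<omega>) s u) \<in> borel_measurable M" for u
    using measurable_cong[of M "\<lambda>\<omega>. displacement (\<lambda>u. N u \<omega>) s u" "\<lambda>\<omega>. integral {s..u} (\<lambda>r. ?X r \<omega>)"] displacement_eq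
    by simp
  then have "{\<omega> \<in> space M. \<forall>u\<in>{s..t}. sg * displacement (\<lambda>u. N u \<omega>) s u < y} \<in> sets M"
    by (intro sets_Collect_continuous_less continuous_intros continuous_on_displacement path st) auto
  moreover have "{\<omega> \<in> space M. N t \<omega> - N s \<omega> = n} \<in> sets M"
    using measurable_sets[OF meas[OF st(2)], of "{n}"] by (simp add: vimage_def Int_def conj_commute)
  ultimately have "{\<omega> \<in> space M. \<forall>u\<in>{s..t}. sg * displacement (\<lambda>u. N u \<omega>) s u < y} \<inter>
      {\<omega> \<in> space M. N t \<omega> - N s \<omega> = n} \<in> sets M" by (rule sets.Int)
  also have "{\<omega> \<in> space M. \<forall>u\<in>{s..t}. sg * displacement (\<lambda>u. N u \<omega>) s u < y} \<inter>
      {\<omega> \<in> space M. N t \<omega> - N s \<omega> = n} = {\<omega> \<in> space M. survival (\<lambda>u. N u \<omega>) t sg n s y}"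
  proof -
    have "N t \<omega> - N s \<omega> = n \<longleftrightarrow> N t \<omega> = N s \<omega> + n" if "\<omega> \<in> space M" for \<omega>
      using jump_path_mono[OF path[OF that] st] by auto
    then show ?thesis by (auto simp: survival_def)
  qed
  finally show ?thesis .
qed

lemma Int_stable_future_generator: "Int_stable (future_generator M N s)"
proof (rule Int_stableI)
  fix a b assume "a \<in> future_generator M N s" "b \<in> future_generator M N s"
  then obtain J A K B where *: "finite J" "J \<subseteq> {s..}" "finite K" "K \<subseteq> {s..}"
    and a: "a = {\<omega> \<in> space M. \<forall>u\<in>J. N u \<omega> - N s \<omega> \<in> A u}"
    and b: "b = {\<omega> \<in> space M. \<forall>u\<in>K. N u \<omega> - N s \<omega> \<in> B u}"
    unfolding future_generator_def by blast
  let ?C = "\<lambda>u. (if u \<in> J then A u else UNIV) \<inter> (if u \<in> K then B u else UNIV)"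
  have "a \<inter> b = {\<omega> \<in> space M. \<forall>u\<in>J \<union> K. N u \<omega> - N s \<omega> \<in> ?C u}"
    unfolding a b by auto
  then show "a \<inter> b \<in> future_generator M N s"
    unfolding future_generator_def using *
    by (intro CollectI exI[of _ "J \<union> K"] exI[of _ ?C]) simp
qed

subsection \<open>Independence of the future\<close>

context poisson_process
begin

lemma jump_path_sample: "\<omega> \<in> space M \<Longrightarrow> jump_path (\<lambda>u. N u \<omega>)"
  using mono_path right_continuous_path by (auto simp: jump_path_def)

lemma measurable_increment: "0 \<le> s \<Longrightarrow> s \<le> u \<Longrightarrow> (\<lambda>\<omega>. N u \<omega> - N s \<omega>) \<in> measurable M (count_space UNIV)"
  by (intro measurable_compose_countable[where f="\<lambda>i \<omega>. i - N s \<omega>", OF _ random_variable_N]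
      measurable_compose[OF random_variable_N]) auto

lemma prob_increment:
  assumes "0 \<le> s" "s < t"
  shows "prob {\<omega> \<in> space M. N t \<omega> - N s \<omega> = j} = exp (- (rate * (t - s))) * (rate * (t - s)) ^ j / fact j"
proof -
  have "prob {\<omega> \<in> space M. N t \<omega> - N s \<omega> = j} =
      measure (distr M (count_space UNIV) (\<lambda>\<omega>. N t \<omega> - N s \<omega>)) {j}"
    using assms by (subst measure_distr) (auto intro!: measurable_increment arg_cong[where f=prob])
  also have "\<dots> = pmf (poisson_pmf (rate * (t - s))) j"
    using assms by (simp add: increments_poisson pmf.rep_eq)
  finally show ?thesis using assms rate_pos by (simp add: mult_ac)
qed

text \<open>With the finitely many times of the cylinder sorted, increments from \<open>s\<close>
  are partial sums of consecutive increments. The cylinder is thus a function of a block of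
  increments disjoint from the one over \<open>[r, s]\<close>.\<close>

lemma indep_increment_future_generator:
  assumes "0 \<le> r" "r \<le> s" and a: "a \<in> future_generator M N s"
  shows "a \<in> events" and "prob ({\<omega> \<in> space M. N s \<omega> - N r \<omega> \<in> B} \<inter> a) =
    prob {\<omega> \<in> space M. N s \<omega> - N r \<omega> \<in> B} * prob a"
proof -
  obtain J A where J: "finite J" "J \<subseteq> {s..}"
    and a_eq: "a = {\<omega> \<in> space M. \<forall>u\<in>J. N u \<omega> - N s \<omega> \<in> A u}"
    using a unfolding future_generator_def by blast
  define L where "L = sorted_list_of_set J"
  define m where "m = length L"
  \<comment> \<open>The times \<open>r\<close>, \<open>s\<close> and then those of \<open>J\<close>
    in order: increment \<open>0\<close> covers \<open>[r, s]\<close>, increments \<open>1\<close>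
    to \<open>m\<close> lie after \<open>s\<close>.\<close>
  define \<tau> where "\<tau> i = (if i = 0 then r else if i \<le> Suc m then (s # L) ! (i - 1) else 0)" for i
  have setL: "set L = J" and sL: "sorted (s # L)"
    using J by (auto simp: L_def)
  have mono: "\<tau> i \<le> \<tau> (Suc i)" if "i < Suc m" for i
    using sorted_nth_mono[OF sL, of "i - 1" i] assms that by (cases i) (auto simp: \<tau>_def m_def)
  have \<tau>s: "\<tau> (Suc 0) = s" and \<tau>0: "\<tau> 0 = r" by (auto simp: \<tau>_def)
  have s_le: "s \<le> \<tau> (Suc i)" if "i \<le> m" for i
    using sorted_nth_mono[OF sL, of 0 i] that by (auto simp: \<tau>_def m_def)
  let ?I = "\<lambda>i \<omega>. N (\<tau> (Suc i)) \<omega> - N (\<tau> i) \<omega>"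
  let ?c = "\<lambda>_::nat. count_space (UNIV::nat set)"
  let ?Y = "\<lambda>\<omega>. restrict (\<lambda>i. ?I i \<omega>) {1..<Suc m}"
  let ?Z = "\<lambda>\<omega>. restrict (\<lambda>i. ?I i \<omega>) {0}"
  let ?P = "PiM {1..<Suc m} ?c"
  have "indep_vars ?c ?I {..<Suc m}"
    using mono assms by (intro increments_indep) (auto simp: \<tau>0)
  then have ind: "indep_var (PiM {0} ?c) ?Z ?P ?Y"
    by (rule indep_var_restrict) auto
  define C where "C = {f \<in> space (PiM {0} ?c). f 0 \<in> B}"
  have C: "C \<in> sets (PiM {0} ?c)"
    using measurable_sets[OF measurable_component_singleton[of 0 "{0}" ?c], of B]
    by (simp add: C_def vimage_def Int_def conj_commute)
  have inc: "{\<omega> \<in> space M. N s \<omega> - N r \<omega> \<in> B} = ?Z -` C \<inter> space M"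
    by (auto simp: C_def space_PiM \<tau>s \<tau>0)
  define D where "D = {f \<in> space ?P. \<forall>i\<in>{1..m}. (\<Sum>j\<in>{1..<Suc i}. f j) \<in> A (\<tau> (Suc i))}"
  have D: "D \<in> sets ?P"
  proof -
    have "(\<lambda>f. \<Sum>j\<in>{1..<Suc i}. f j) \<in> measurable ?P (count_space UNIV)" if "i \<in> {1..m}" for i
      using that by (intro measurable_sum_nat measurable_component_singleton) auto
    then have "{f \<in> space ?P. (\<Sum>j\<in>{1..<Suc i}. f j) \<in> A (\<tau> (Suc i))} \<in> sets ?P" if "i \<in> {1..m}" for i
      using measurable_sets[of "\<lambda>f. \<Sum>j\<in>{1..<Suc i}. f j" ?P "count_space UNIV" "A (\<tau> (Suc i))"] that
      by (simp add: vimage_def Int_def conj_commute)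
    then show ?thesis
      unfolding D_def by (intro sets.sets_Collect_finite_All) auto
  qed
  \<comment> \<open>By monotonicity of the path the truncated differences telescope.\<close>
  have sums: "(\<Sum>j\<in>{1..<Suc i}. ?Y \<omega> j) = N (\<tau> (Suc i)) \<omega> - N s \<omega>"
    if "\<omega> \<in> space M" "i \<le> m" for i \<omega>
    using that(2)
  proof (induction i)
    case (Suc i)
    have "N s \<omega> \<le> N (\<tau> (Suc i)) \<omega>" "N (\<tau> (Suc i)) \<omega> \<le> N (\<tau> (Suc (Suc i))) \<omega>"
      using Suc.prems assms s_le[of i] mono[of "Suc i"] that(1) by (auto intro!: mono_path)
    then show ?case using Suc by simp
  qed (simp add: \<tau>s)
  have a_Y: "a = ?Y -` D \<inter> space M"
  proof -
    have J_eq: "J = (\<lambda>i. \<tau> (Suc i)) ` {1..m}"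
    proof -
      have "(\<lambda>i. \<tau> (Suc i)) ` {1..m} = (\<lambda>i. L ! i) ` {..<m}"
      proof -
        have "{1..m} = Suc ` {..<m}" by (auto simp: image_iff Suc_le_eq gr0_conv_Suc)
        then have "(\<lambda>i. \<tau> (Suc i)) ` {1..m} = (\<lambda>i. \<tau> (Suc (Suc i))) ` {..<m}"
          by (simp add: image_image)
        also have "\<dots> = (\<lambda>i. L ! i) ` {..<m}"
          by (intro image_cong) (auto simp: \<tau>_def)
        finally show ?thesis .
      qed
      then show ?thesis using setL by (auto simp: m_def in_set_conv_nth)
    qed
    have "\<omega> \<in> a \<longleftrightarrow> ?Y \<omega> \<in> D" if \<omega>: "\<omega> \<in> space M" for \<omega>
    proof -
      have "?Y \<omega> \<in> space ?P" by (auto simp: space_PiM)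
      then have "?Y \<omega> \<in> D \<longleftrightarrow> (\<forall>i\<in>{1..m}. (\<Sum>j\<in>{1..<Suc i}. ?Y \<omega> j) \<in> A (\<tau> (Suc i)))"
        by (simp only: D_def mem_Collect_eq simp_thms)
      also have "\<dots> \<longleftrightarrow> (\<forall>i\<in>{1..m}. N (\<tau> (Suc i)) \<omega> - N s \<omega> \<in> A (\<tau> (Suc i)))"
      proof (rule ball_cong[OF refl])
        fix i assume "i \<in> {1..m}"
        then have "i \<le> m" by simp
        show "(\<Sum>j\<in>{1..<Suc i}. ?Y \<omega> j) \<in> A (\<tau> (Suc i)) \<longleftrightarrow> N (\<tau> (Suc i)) \<omega> - N s \<omega> \<in> A (\<tau> (Suc i))"
          unfolding sums[OF \<omega> \<open>i \<le> m\<close>] ..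
      qed
      finally show ?thesis using \<omega> by (simp add: a_eq J_eq)
    qed
    then show ?thesis by (auto simp: a_eq)
  qed
  show "a \<in> events"
    using indep_var_rv2[OF ind] D unfolding a_Y by (rule measurable_sets)
  have "prob ((?Z -` C \<inter> space M) \<inter> (?Y -` D \<inter> space M)) =
      prob (?Z -` C \<inter> space M) * prob (?Y -` D \<inter> space M)"
  proof (rule indep_setD)
    show "indep_set (sigma_sets (space M) {?Z -` A \<inter> space M |A. A \<in> sets (PiM {0} ?c)})
        (sigma_sets (space M) {?Y -` A \<inter> space M |A. A \<in> sets ?P})"
      using ind unfolding indep_var_eq by (elim conjE)
    show "?Z -` C \<inter> space M \<in> sigma_sets (space M) {?Z -` A \<inter> space M |A. A \<in> sets (PiM {0} ?c)}"
      using C by (intro sigma_sets.Basic CollectI exI[of _ C] conjI refl)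
    show "?Y -` D \<inter> space M \<in> sigma_sets (space M) {?Y -` A \<inter> space M |A. A \<in> sets ?P}"
      using D by (intro sigma_sets.Basic CollectI exI[of _ D] conjI refl)
  qed
  then show "prob ({\<omega> \<in> space M. N s \<omega> - N r \<omega> \<in> B} \<inter> a) =
    prob {\<omega> \<in> space M. N s \<omega> - N r \<omega> \<in> B} * prob a" unfolding a_Y inc .
qed

text \<open>On the sigma-algebra generated by the cylinders the increments after \<open>s\<close>
  are measurable by construction, so \<open>survival_sets\<close> applies there.\<close>

lemma survival_in_future:
  assumes "0 \<le> s" "s \<le> t"
  shows "{\<omega> \<in> space M. survival (\<lambda>u. N u \<omega>) t sg n s y} \<in> sigma_sets (space M) (future_generator M N s)"
proof -
  let ?F = "sigma (space M) (future_generator M N s)"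
  have sub: "future_generator M N s \<subseteq> Pow (space M)" by (auto simp: future_generator_def)
  have "{\<omega> \<in> space ?F. survival (\<lambda>u. N u \<omega>) t sg n s y} \<in> sets ?F"
  proof (rule survival_sets)
    fix u assume u: "s \<le> u"
    show "(\<lambda>\<omega>. N u \<omega> - N s \<omega>) \<in> measurable ?F (count_space UNIV)"
    proof (rule measurableI)
      fix A :: "nat set"
      have "{\<omega> \<in> space M. \<forall>u'\<in>{u}. N u' \<omega> - N s \<omega> \<in> A} \<in> future_generator M N s"
        unfolding future_generator_def using u by (intro CollectI exI[of _ "{u}"] exI[of _ "\<lambda>_. A"]) auto
      then have "{\<omega> \<in> space M. N u \<omega> - N s \<omega> \<in> A} \<in> sets ?F" using sub by auto
      also have "{\<omega> \<in> space M. N u \<omega> - N s \<omega> \<in> A} = (\<lambda>\<omega>. N u \<omega> - N s \<omega>) -` A \<inter> space ?F" using sub by auto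
      finally show "(\<lambda>\<omega>. N u \<omega> - N s \<omega>) -` A \<inter> space ?F \<in> sets ?F" .
    qed simp
  qed (use sub assms jump_path_sample in auto)
  then show ?thesis using sub by simp
qed

lemma survival_events:
  assumes "0 \<le> s" "s \<le> t"
  shows "{\<omega> \<in> space M. survival (\<lambda>u. N u \<omega>) t sg n s y} \<in> events"
  using assms by (intro survival_sets jump_path_sample measurable_increment) auto

text \<open>Independence on cylinders extends to the generated sigma-algebras because both
  generators are stable under intersection; the survival event belongs to the one of the
  future.\<close>

lemma prob_survival_indep:
  assumes "0 \<le> r" "r \<le> s" "s \<le> t"
  shows "prob ({\<omega> \<in> space M. N s \<omega> - N r \<omega> = j} \<inter> {\<omega> \<in> space M. survival (\<lambda>u. N u \<omega>) t sg n s y}) =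
    prob {\<omega> \<in> space M. N s \<omega> - N r \<omega> = j} * prob {\<omega> \<in> space M. survival (\<lambda>u. N u \<omega>) t sg n s y}"
proof -
  let ?P = "{{\<omega> \<in> space M. N s \<omega> - N r \<omega> \<in> B} | B. True}"
  have "indep_set ?P (future_generator M N s)"
  proof (rule indep_setI)
    show "?P \<subseteq> events"
    proof safe
      fix B
      show "{\<omega> \<in> space M. N s \<omega> - N r \<omega> \<in> B} \<in> events"
        using measurable_sets[OF measurable_increment[OF assms(1,2)], of B]
        by (simp add: vimage_def Int_def conj_commute)
    qed
    show "future_generator M N s \<subseteq> events"
      using indep_increment_future_generator(1)[OF assms(1,2)] by blast
    fix a b assume "a \<in> ?P" "b \<in> future_generator M N s"
    then show "prob (a \<inter> b) = prob a * prob b"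
      using indep_increment_future_generator(2)[OF assms(1,2)] by blast
  qed
  moreover have "Int_stable ?P"
  proof (rule Int_stableI)
    fix a b assume "a \<in> ?P" "b \<in> ?P"
    then obtain A B where "a = {\<omega> \<in> space M. N s \<omega> - N r \<omega> \<in> A}" "b = {\<omega> \<in> space M. N s \<omega> - N r \<omega> \<in> B}"
      by auto
    then have "a \<inter> b = {\<omega> \<in> space M. N s \<omega> - N r \<omega> \<in> A \<inter> B}" by auto
    then show "a \<inter> b \<in> ?P" by blast
  qed
  ultimately have "indep_set (sigma_sets (space M) ?P) (sigma_sets (space M) (future_generator M N s))"
    by (rule indep_set_sigma_sets[OF _ _ Int_stable_future_generator])
  moreover have "{\<omega> \<in> space M. N s \<omega> - N r \<omega> = j} \<in> sigma_sets (space M) ?P"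
    by (intro sigma_sets.Basic CollectI exI[of _ "{j}"]) auto
  ultimately show ?thesis
    by (rule indep_setD[OF _ _ survival_in_future]) (use assms in auto)
qed

end

subsection \<open>Behaviour over a short time\<close>

lemma displacement_self [simp]: "displacement p s s = 0"
  by (simp add: displacement_def)

text \<open>Up to time \<open>s\<close> the particle runs straight, so only its distance to the
  barrier changes, by \<open>sg * (s - r)\<close>.\<close>

lemma survival_no_jump:
  assumes p: "jump_path p" and rst: "0 \<le> r" "r \<le> s" "s \<le> t"
    and y: "0 < y" and sg: "sg = 1 \<or> sg = - 1" and eq: "p s = p r"
  shows "survival p t sg n r y \<longleftrightarrow> survival p t sg n s (y - sg * (s - r))"
proof -
  have late: "displacement p r u = (s - r) + displacement p s u" if "s \<le> u" for u
    using displacement_split[OF p, of r s u] displacement_constant[OF p, of r s] rst eq that by simp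
  have early: "displacement p r u = u - r" if "r \<le> u" "u \<le> s" for u
    using displacement_constant[OF p, of r u] jump_path_mono[OF p, of r u] jump_path_mono[OF p, of u s] rst eq that by simp
  have "(\<forall>u\<in>{r..t}. sg * displacement p r u < y) \<longleftrightarrow> (\<forall>u\<in>{s..t}. sg * displacement p s u < y - sg * (s - r))"
  proof
    assume *: "\<forall>u\<in>{r..t}. sg * displacement p r u < y"
    show "\<forall>u\<in>{s..t}. sg * displacement p s u < y - sg * (s - r)"
    proof
      fix u assume u: "u \<in> {s..t}"
      then have "sg * displacement p r u < y" using * rst by auto
      then show "sg * displacement p s u < y - sg * (s - r)" using late[of u] u sg by auto
    qed
  next
    assume *: "\<forall>u\<in>{s..t}. sg * displacement p s u < y - sg * (s - r)"
    \<comment> \<open>Taking \<open>u = s\<close>, where the displacement from \<open>s\<close>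
      vanishes; this positivity settles the times before \<open>s\<close>.\<close>
    then have "0 < y - sg * (s - r)" using rst by force
    then have "sg * displacement p r u < y" if "u \<in> {r..t}" for u
    proof (cases "s \<le> u")
      case True
      then have "sg * displacement p s u < y - sg * (s - r)" using * that by auto
      then show ?thesis using late[OF True] sg by auto
    next
      case False
      then show ?thesis using early[of u] \<open>0 < y - sg * (s - r)\<close> that sg y by auto
    qed
    then show "\<forall>u\<in>{r..t}. sg * displacement p r u < y" by blast
  qed
  then show ?thesis using eq by (simp add: survival_def)
qed

text \<open>The exact place of the jump in \<open>[r, s]\<close> is unknown, but the particle stays
  within \<open>s - r\<close> of its start meanwhile. Hence there are two inclusions, with the
  barrier moved by \<open>s - r\<close> either way, instead of an equivalence; they agree in the
  limit of short intervals.\<close>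

lemma survival_one_jump:
  assumes p: "jump_path p" and rst: "0 \<le> r" "r \<le> s" "s \<le> t"
    and sg: "sg = 1 \<or> sg = - 1" and eq: "p s = p r + 1"
  shows "survival p t (- sg) n s (y - (s - r)) \<Longrightarrow> survival p t sg (Suc n) r y"
    and "survival p t sg (Suc n) r y \<Longrightarrow> survival p t (- sg) n s (y + (s - r))"
proof -
  have late: "displacement p r u = displacement p r s - displacement p s u" if "s \<le> u" for u
    using displacement_split[OF p, of r s u] rst eq that by (simp add: power_add[symmetric] mult_2[symmetric])
  have early: "\<bar>displacement p r u\<bar> \<le> s - r" if "r \<le> u" "u \<le> s" for u
    using abs_displacement_le[OF p, of r u] rst that by simp
  show "survival p t sg (Suc n) r y" if *: "survival p t (- sg) n s (y - (s - r))"
  proof -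
    have "0 < y - (s - r)" using * rst unfolding survival_def by force
    then have "sg * displacement p r u < y" if "u \<in> {r..t}" for u
    proof (cases "s \<le> u")
      case True
      then have "- sg * displacement p s u < y - (s - r)" using * that by (auto simp: survival_def)
      then show ?thesis using late[OF True] early[of s] rst sg by auto
    next
      case False
      then show ?thesis using early[of u] \<open>0 < y - (s - r)\<close> that sg by auto
    qed
    then show ?thesis using * eq by (auto simp: survival_def)
  qed
  show "survival p t (- sg) n s (y + (s - r))" if *: "survival p t sg (Suc n) r y"
  proof -
    have "- sg * displacement p s u < y + (s - r)" if u: "u \<in> {s..t}" for u
    proof -
      have "sg * displacement p r u < y" using * u rst by (auto simp: survival_def)
      then show ?thesis using late[of u] early[of s] u sg rst by auto
    qed
    then show ?thesis using * eq by (auto simp: survival_def)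
  qed
qed

text \<open>The left side is the probability that a Poisson variable with mean \<open>x\<close> is
  at least \<open>2\<close>.\<close>

lemma one_minus_Poisson_le:
  fixes x :: real
  assumes "0 \<le> x"
  shows "1 - exp (- x) - exp (- x) * x \<le> x\<^sup>2"
proof -
  have "(1 - x) * (1 + x) \<le> exp (- x) * (1 + x)"
    using exp_ge_add_one_self[of "- x"] assms by (intro mult_right_mono) auto
  then show ?thesis by (simp add: algebra_simps power2_eq_square)
qed

section \<open>Short-time estimates for the survival probabilities\<close>

context poisson_process
begin

definition survival_prob :: "real \<Rightarrow> real \<Rightarrow> nat \<Rightarrow> real \<Rightarrow> real \<Rightarrow> real" where
  "survival_prob t sg n s y = prob {\<omega> \<in> space M. survival (\<lambda>u. N u \<omega>) t sg n s y}"

lemma increment_events: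
  assumes "0 \<le> r" "r \<le> s"
  shows "{\<omega> \<in> space M. N s \<omega> - N r \<omega> \<in> B} \<in> events"
  using measurable_sets[OF measurable_increment[OF assms], of B]
  by (simp add: vimage_def Int_def conj_commute)

lemma survival_prob_no_jump:
  assumes rst: "0 \<le> r" "r < s" "s \<le> t" and y: "0 < y" and sg: "sg = 1 \<or> sg = - 1"
  shows "prob ({\<omega> \<in> space M. N s \<omega> - N r \<omega> = 0} \<inter> {\<omega> \<in> space M. survival (\<lambda>u. N u \<omega>) t sg n r y}) =
    exp (- (rate * (s - r))) * survival_prob t sg n s (y - sg * (s - r))"
proof -
  have "{\<omega> \<in> space M. N s \<omega> - N r \<omega> = 0} \<inter> {\<omega> \<in> space M. survival (\<lambda>u. N u \<omega>) t sg n r y} =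
    {\<omega> \<in> space M. N s \<omega> - N r \<omega> = 0} \<inter> {\<omega> \<in> space M. survival (\<lambda>u. N u \<omega>) t sg n s (y - sg * (s - r))}"
  proof -
    have "survival (\<lambda>u. N u \<omega>) t sg n r y \<longleftrightarrow> survival (\<lambda>u. N u \<omega>) t sg n s (y - sg * (s - r))"
      if "\<omega> \<in> space M" "N s \<omega> - N r \<omega> = 0" for \<omega>
      using survival_no_jump[OF jump_path_sample[OF that(1)], of r s t y sg n] mono_path[OF that(1), of r s] that assms
      by auto
    then show ?thesis by blast
  qed
  then show ?thesis
    using prob_survival_indep[of r s t 0 sg n] prob_increment[of r s 0] rst
    by (simp add: survival_prob_def)
qed

lemma prob_jump_le:
  assumes "0 \<le> r" "r < s"
  shows "prob {\<omega> \<in> space M. N s \<omega> - N r \<omega> \<noteq> 0} \<le> rate * (s - r)"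
proof -
  have "{\<omega> \<in> space M. N s \<omega> - N r \<omega> \<noteq> 0} = space M - {\<omega> \<in> space M. N s \<omega> - N r \<omega> = 0}" by auto
  then have "prob {\<omega> \<in> space M. N s \<omega> - N r \<omega> \<noteq> 0} = 1 - exp (- (rate * (s - r)))"
    using prob_increment[OF assms, of 0] increment_events[of r s "{0}"] assms
    by (simp add: prob_compl)
  then show ?thesis using exp_ge_add_one_self[of "- (rate * (s - r))"] by simp
qed

text \<open>Without a jump the survival event is transported along the characteristic, and a jump
  has probability at most \<open>rate * (s - r)\<close>. This gives continuity along characteristics
  up to their endpoints.\<close>

lemma survival_prob_Lipschitz:
  assumes rst: "0 \<le> r" "r < s" "s \<le> t" and y: "0 < y" and sg: "sg = 1 \<or> sg = - 1"
  shows "\<bar>survival_prob t sg n r y - survival_prob t sg n s (y - sg * (s - r))\<bar> \<le> rate * (s - r)"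
proof -
  let ?X = "{\<omega> \<in> space M. N s \<omega> - N r \<omega> = 0}"
  let ?E = "{\<omega> \<in> space M. survival (\<lambda>u. N u \<omega>) t sg n r y}"
  let ?x = "rate * (s - r)" and ?P = "survival_prob t sg n s (y - sg * (s - r))"
  have ev: "?X \<in> events" "?E \<in> events"
    using increment_events[of r s "{0}"] survival_events rst by auto
  have "prob ?E = prob (?X \<inter> ?E) + prob (?E - ?X)"
    using ev finite_measure_Diff'[of ?E ?X] by (simp add: Int_commute)
  moreover have "prob (?E - ?X) \<le> prob {\<omega> \<in> space M. N s \<omega> - N r \<omega> \<noteq> 0}"
    using increment_events[of r s "- {0}"] rst by (intro finite_measure_mono) auto
  ultimately have "prob ?E \<le> exp (- ?x) * ?P + ?x" "exp (- ?x) * ?P \<le> prob ?E"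
    using survival_prob_no_jump[OF assms, of n] prob_jump_le[OF rst(1,2)]
      measure_nonneg[of M "?E - ?X"] by linarith+
  moreover have "?P * 1 - ?P * ?x \<le> ?P * exp (- ?x)"
    unfolding right_diff_distrib[symmetric]
    using exp_ge_add_one_self[of "- ?x"] by (intro mult_left_mono) (auto simp: survival_prob_def)
  moreover have "?P * ?x \<le> 1 * ?x"
    using rate_pos rst by (intro mult_right_mono) (auto simp: survival_prob_def)
  moreover have "exp (- ?x) * ?P \<le> 1 * ?P"
    using rate_pos rst by (intro mult_right_mono) (auto simp: survival_prob_def)
  ultimately show ?thesis
    by (simp add: survival_prob_def[of t sg n r y] mult.commute[of "exp (- ?x)"] abs_le_iff)
qed

text \<open>Split by the number of jumps in \<open>[r, s]\<close>: none transports the event, one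
  reverses the direction and uses up a jump, and two or more cost at most
  \<open>x\<^sup>2\<close>.\<close>

lemma survival_prob_step:
  assumes rst: "0 \<le> r" "r < s" "s \<le> t" and y: "0 < y" and sg: "sg = 1 \<or> sg = - 1"
  defines "h \<equiv> s - r" and "x \<equiv> rate * (s - r)"
  shows "exp (- x) * survival_prob t sg (Suc n) s (y - sg * h)
      + exp (- x) * x * survival_prob t (- sg) n s (y - h) \<le> survival_prob t sg (Suc n) r y" (is ?lower)
    and "survival_prob t sg (Suc n) r y \<le> exp (- x) * survival_prob t sg (Suc n) s (y - sg * h)
      + exp (- x) * x * survival_prob t (- sg) n s (y + h) + x\<^sup>2" (is ?upper)
proof -
  define X where "X = (\<lambda>j. {\<omega> \<in> space M. N s \<omega> - N r \<omega> = j})"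
  let ?E = "{\<omega> \<in> space M. survival (\<lambda>u. N u \<omega>) t sg (Suc n) r y}"
  let ?F = "\<lambda>y. {\<omega> \<in> space M. survival (\<lambda>u. N u \<omega>) t (- sg) n s y}"
  have ev: "X j \<in> events" "?E \<in> events" "?F y' \<in> events" for j y'
    using increment_events[of r s "{j}"] survival_events rst by (auto simp: X_def)
  have disj: "X 0 \<inter> X 1 = {}" by (auto simp: X_def)
  have X_prob: "prob (X j) = exp (- x) * x ^ j / fact j" for j
    using prob_increment[of r s j] rst by (simp add: X_def x_def)
  have x0: "0 \<le> x" using rst rate_pos by (simp add: x_def)
  have one: "prob (X 1 \<inter> ?F y') = exp (- x) * x * survival_prob t (- sg) n s y'" for y'
    using prob_survival_indep[of r s t 1 "- sg" n y'] X_prob[of 1] rst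
    by (simp add: survival_prob_def X_def)
  have zero: "prob (X 0 \<inter> ?E) = exp (- x) * survival_prob t sg (Suc n) s (y - sg * h)"
    using survival_prob_no_jump[OF rst y sg, of "Suc n"] by (simp add: x_def h_def X_def)
  let ?R = "space M - (X 0 \<union> X 1)"
  have "prob (X 0 \<union> X 1) = prob (X 0) + prob (X 1)"
    using ev disj by (intro finite_measure_Union) auto
  then have R: "prob ?R = 1 - exp (- x) - exp (- x) * x"
    using ev X_prob[of 0] X_prob[of 1] by (subst prob_compl) auto
  have split: "prob ?E = prob (X 0 \<inter> ?E) + prob (X 1 \<inter> ?E) + prob (?R \<inter> ?E)"
  proof -
    have "prob ((X 0 \<inter> ?E) \<union> (X 1 \<inter> ?E) \<union> (?R \<inter> ?E)) =
      prob ((X 0 \<inter> ?E) \<union> (X 1 \<inter> ?E)) + prob (?R \<inter> ?E)"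
      using ev by (intro finite_measure_Union) auto
    also have "prob ((X 0 \<inter> ?E) \<union> (X 1 \<inter> ?E)) = prob (X 0 \<inter> ?E) + prob (X 1 \<inter> ?E)"
      using ev disj by (intro finite_measure_Union) auto
    also have "(X 0 \<inter> ?E) \<union> (X 1 \<inter> ?E) \<union> (?R \<inter> ?E) = ?E" by (auto simp: X_def)
    finally show ?thesis .
  qed
  have jump: "N s \<omega> = N r \<omega> + 1" if "\<omega> \<in> X 1" for \<omega>
    using that by (auto simp: X_def)
  have "X 1 \<inter> ?F (y - h) \<subseteq> X 1 \<inter> ?E"
  proof
    fix \<omega> assume \<omega>: "\<omega> \<in> X 1 \<inter> ?F (y - h)"
    then have "\<omega> \<in> X 1" and sp: "\<omega> \<in> space M" by auto
    note step = survival_one_jump(1)[OF jump_path_sample[OF sp] rst(1) less_imp_le[OF rst(2)] rst(3) sg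
        jump[OF \<open>\<omega> \<in> X 1\<close>], folded h_def]
    show "\<omega> \<in> X 1 \<inter> ?E"
      using \<omega> step[of n y] by simp
  qed
  then have low: "prob (X 1 \<inter> ?F (y - h)) \<le> prob (X 1 \<inter> ?E)"
    using ev by (intro finite_measure_mono) auto
  have "X 1 \<inter> ?E \<subseteq> X 1 \<inter> ?F (y + h)"
  proof
    fix \<omega> assume \<omega>: "\<omega> \<in> X 1 \<inter> ?E"
    then have "\<omega> \<in> X 1" and sp: "\<omega> \<in> space M" by auto
    note step = survival_one_jump(2)[OF jump_path_sample[OF sp] rst(1) less_imp_le[OF rst(2)] rst(3) sg
        jump[OF \<open>\<omega> \<in> X 1\<close>], folded h_def]
    show "\<omega> \<in> X 1 \<inter> ?F (y + h)"
      using \<omega> step[of n y] by simp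
  qed
  then have up: "prob (X 1 \<inter> ?E) \<le> prob (X 1 \<inter> ?F (y + h))"
    using ev by (intro finite_measure_mono) auto
  have "prob (?R \<inter> ?E) \<le> prob ?R"
    using ev by (intro finite_measure_mono) auto
  then have R': "prob (?R \<inter> ?E) \<le> x\<^sup>2"
    using R one_minus_Poisson_le[OF x0] by linarith
  have R0: "0 \<le> prob (?R \<inter> ?E)" by simp
  have E: "survival_prob t sg (Suc n) r y = prob ?E" by (simp add: survival_prob_def)
  show ?lower using split zero low one[of "y - h"] R0 unfolding E by linarith
  show ?upper using split zero up one[of "y + h"] R' unfolding E by linarith
qed

end

subsection \<open>The transport equation along characteristics\<close>

context poisson_process
begin

text \<open>
  After removing the factor \<open>exp (- rate * (t - s)) * rate ^ Suc n\<close>, the survival probability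
  with \<open>Suc n\<close> jumps has derivative \<open>- W\<close> along the line on which the particle runs without
  turning: a path with one jump in a short interval \<open>[p, q]\<close> lies, up to \<open>q - p\<close> in the
  distance to the barrier, among those that start in the opposite direction at time \<open>q\<close>
  with \<open>n\<close> jumps left.
\<close>

lemma survival_prob_along_characteristic:
  fixes V :: "real \<Rightarrow> real" and W :: "real \<Rightarrow> real \<Rightarrow> real"
  assumes ab: "0 \<le> a" "a < b" "b \<le> t" and sg: "sg = 1 \<or> sg = - 1"
    and pos: "\<And>s. a \<le> s \<Longrightarrow> s < b \<Longrightarrow> 0 < y0 - sg * (s - a)"
    and below: "\<And>s. a < s \<Longrightarrow> s < b \<Longrightarrow> y0 - sg * (s - a) < t - s"
    and W: "\<And>s y. 0 \<le> s \<Longrightarrow> 0 < y \<Longrightarrow> y < t - s \<Longrightarrow>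
      survival_prob t (- sg) n s y = exp (- (rate * (t - s))) * rate ^ n * W s y"
    and W_cont: "\<And>x y. isCont (\<lambda>(s, y). W s y) (x, y)"
    and V: "\<And>s. (V has_real_derivative - W s (y0 - sg * (s - a))) (at s)"
    and V_end: "survival_prob t sg (Suc n) b (y0 - sg * (b - a)) =
      exp (- (rate * (t - b))) * rate ^ Suc n * V b"
  shows "survival_prob t sg (Suc n) a y0 = exp (- (rate * (t - a))) * rate ^ Suc n * V a"
proof -
  define y where "y s = y0 - sg * (s - a)" for s
  define P where "P s = survival_prob t sg (Suc n) s (y s)" for s
  \<comment> \<open>Both \<open>f\<close> and \<open>g\<close> are survival probabilities with the
    Poisson factor removed; this absorbs the factor \<open>exp (- x)\<close> of a short
    step.\<close>
  define f where "f s = P s * (exp (rate * (t - s)) / rate ^ Suc n)" for s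
  define g where "g s z = survival_prob t (- sg) n s z * (exp (rate * (t - s)) / rate ^ n)" for s z
  \<comment> \<open>Bounds the rescaled contribution of two or more jumps uniformly in time, since
    the exponential factor is largest at time \<open>0\<close>.\<close>
  define K where "K = rate\<^sup>2 * (exp (rate * t) / rate ^ Suc n)"
  have y_shift: "y p - sg * (q - p) = y q" for p q
    by (simp add: y_def algebra_simps)
  have scale: "exp (- u) * c * w * (exp u / c) = (if c = 0 then 0 else w)" for u c w :: real
    by (simp add: exp_minus)
  have unscale: "p * (e / c) = v \<Longrightarrow> e \<noteq> 0 \<Longrightarrow> c \<noteq> 0 \<Longrightarrow> p = inverse e * c * v" for p e c v :: real
    by (auto simp: field_simps)
  have g_W: "g s z = W s z" if "0 \<le> s" "0 < z" "z < t - s" for s z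
    unfolding g_def W[OF that] scale using rate_pos by simp
  have bounds: "(q - p) * g q (y p - (q - p)) \<le> f p - f q"
    "f p - f q \<le> (q - p) * g q (y p + (q - p)) + K * (q - p)\<^sup>2"
    if pq: "a \<le> p" "p < q" "q \<le> b" for p q
  proof -
    let ?c = "exp (rate * (t - p)) / rate ^ Suc n" and ?x = "rate * (q - p)"
    have c: "0 \<le> ?c" using rate_pos by simp
    have ec: "exp (- ?x) * ?c = exp (rate * (t - q)) / rate ^ Suc n"
      by (simp add: exp_add[symmetric] algebra_simps)
    have P: "exp (- ?x) * P q * ?c = f q"
      unfolding f_def ec[symmetric] by (simp only: mult_ac)
    have G: "exp (- ?x) * ?x * survival_prob t (- sg) n q z * ?c = (q - p) * g q z" for z
    proof -
      have "exp (- ?x) * ?x * survival_prob t (- sg) n q z * ?c =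
          ?x * survival_prob t (- sg) n q z * (exp (- ?x) * ?c)" by (simp only: mult_ac)
      also have "\<dots> = (q - p) * g q z"
        unfolding ec g_def using rate_pos by (simp add: field_simps)
      finally show ?thesis .
    qed
    have step: "exp (- ?x) * P q + exp (- ?x) * ?x * survival_prob t (- sg) n q (y p - (q - p)) \<le> P p"
      "P p \<le> exp (- ?x) * P q + exp (- ?x) * ?x * survival_prob t (- sg) n q (y p + (q - p)) + ?x\<^sup>2"
      using survival_prob_step[of p q t "y p" sg n] pq ab pos[of p] sg
      unfolding y_shift P_def by (simp_all add: y_def)
    have "f q + (q - p) * g q (y p - (q - p)) \<le> f p"
      using mult_right_mono[OF step(1) c] unfolding distrib_right P G f_def[of p, symmetric] .
    then show "(q - p) * g q (y p - (q - p)) \<le> f p - f q" by simp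
    have "f p \<le> f q + (q - p) * g q (y p + (q - p)) + ?x\<^sup>2 * ?c"
      using mult_right_mono[OF step(2) c] unfolding distrib_right P G f_def[of p, symmetric] .
    moreover have "?x\<^sup>2 * ?c \<le> K * (q - p)\<^sup>2"
    proof -
      have "?x\<^sup>2 * ?c \<le> ?x\<^sup>2 * (exp (rate * t) / rate ^ Suc n)"
        using rate_pos pq ab by (intro mult_left_mono divide_right_mono) auto
      then show ?thesis by (simp add: K_def power_mult_distrib mult_ac)
    qed
    ultimately show "f p - f q \<le> (q - p) * g q (y p + (q - p)) + K * (q - p)\<^sup>2" by simp
  qed
  have f_cont: "continuous_on {a..b} f"
  proof -
    have lip: "\<bar>P p - P q\<bar> \<le> rate * \<bar>p - q\<bar>" if "a \<le> p" "p < q" "q \<le> b" for p q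
      using survival_prob_Lipschitz[of p q t "y p" sg "Suc n"] that ab pos[of p] sg
      unfolding y_shift P_def by (simp add: y_def)
    have "rate-lipschitz_on {a..b} P"
    proof (rule lipschitz_onI)
      fix p q assume "p \<in> {a..b}" "q \<in> {a..b}"
      then show "dist (P p) (P q) \<le> rate * dist p q"
        using lip[of p q] lip[of q p] unfolding dist_real_def
        by (cases p q rule: linorder_cases) (auto simp: abs_minus_commute)
    qed (use rate_pos in simp)
    then have "continuous_on {a..b} P" by (rule lipschitz_on_continuous_on)
    then show ?thesis unfolding f_def by (intro continuous_intros) (use rate_pos in auto)
  qed
  have f_deriv: "(f has_real_derivative - W x (y x)) (at x)" if x: "a < x" "x < b" for x
  proof -
    have yx: "0 < y x" "y x < t - x"
      using pos[of x] below[of x] x by (auto simp: y_def)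
    \<comment> \<open>Ordering \<open>x\<close> and \<open>z\<close> lets one estimate cover the
      left and the right difference quotient.\<close>
    let ?p = "\<lambda>z. min x z" and ?q = "\<lambda>z. max x z"
    let ?h = "\<lambda>z. ?q z - ?p z"
    have lims: "(?p \<longlongrightarrow> x) (at x)" "(?q \<longlongrightarrow> x) (at x)"
      using tendsto_min[OF tendsto_const[of x] tendsto_ident_at, of x UNIV]
        tendsto_max[OF tendsto_const[of x] tendsto_ident_at, of x UNIV] by simp_all
    have h0: "(?h \<longlongrightarrow> 0) (at x)"
      using tendsto_diff[OF lims(2,1)] by simp
    have yp: "((\<lambda>z. y (?p z)) \<longlongrightarrow> y x) (at x)"
      unfolding y_def by (intro tendsto_intros lims)
    have ylo: "((\<lambda>z. y (?p z) - ?h z) \<longlongrightarrow> y x) (at x)"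
      using tendsto_diff[OF yp h0] by simp
    have yhi: "((\<lambda>z. y (?p z) + ?h z) \<longlongrightarrow> y x) (at x)"
      using tendsto_add[OF yp h0] by simp
    have W_lim: "((\<lambda>z. W (?q z) (u z)) \<longlongrightarrow> W x (y x)) (at x)"
      if "(u \<longlongrightarrow> y x) (at x)" for u
      using isCont_tendsto_compose[OF W_cont[of x "y x"] tendsto_Pair[OF lims(2) that]] by simp
    \<comment> \<open>The region where \<open>g\<close> equals \<open>W\<close> is open, so the
      perturbed points lie in it for \<open>z\<close> near \<open>x\<close>.\<close>
    have ev_region: "\<forall>\<^sub>F z in at x. g (?q z) (u z) = W (?q z) (u z)"
      if u: "(u \<longlongrightarrow> y x) (at x)" for u
    proof -
      have "\<forall>\<^sub>F z in at x. 0 < u z" using order_tendstoD(1)[OF u yx(1)] .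
      moreover have "((\<lambda>z. t - ?q z - u z) \<longlongrightarrow> t - x - y x) (at x)"
        by (intro tendsto_intros lims u)
      then have "\<forall>\<^sub>F z in at x. 0 < t - ?q z - u z"
        by (rule order_tendstoD(1)) (use yx in simp)
      ultimately show ?thesis
        by eventually_elim (use x ab in \<open>auto intro!: g_W\<close>)
    qed
    have ev_ab: "\<forall>\<^sub>F z in at x. z \<in> {a<..<b} - {x}"
      using x eventually_at_in_open[of "{a<..<b}" x] by simp
    have quot: "(f z - f x) / (z - x) = - ((f (?p z) - f (?q z)) / ?h z)" if "z \<noteq> x" for z
      using that by (cases z x rule: linorder_cases) (auto simp: min_def max_def field_simps)
    have "((\<lambda>z. (f z - f x) / (z - x)) \<longlongrightarrow> - W x (y x)) (at x)"
    proof (rule tendsto_sandwich)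
      show "((\<lambda>z. - (W (?q z) (y (?p z) + ?h z) + K * ?h z)) \<longlongrightarrow> - W x (y x)) (at x)"
        using tendsto_minus[OF tendsto_add[OF W_lim[OF yhi] tendsto_mult[OF tendsto_const[of K] h0]]] by simp
      show "((\<lambda>z. - W (?q z) (y (?p z) - ?h z)) \<longlongrightarrow> - W x (y x)) (at x)"
        by (rule tendsto_minus[OF W_lim[OF ylo]])
      show "\<forall>\<^sub>F z in at x. - (W (?q z) (y (?p z) + ?h z) + K * ?h z) \<le> (f z - f x) / (z - x)"
        using ev_ab ev_region[OF yhi]
      proof eventually_elim
        case (elim z)
        then have "?p z < ?q z" "a \<le> ?p z" "?q z \<le> b" using x by (auto simp: min_def max_def)
        from bounds(2)[OF this(2,1,3)]
        have "f (?p z) - f (?q z) \<le> (W (?q z) (y (?p z) + ?h z) + K * ?h z) * ?h z"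
          unfolding elim(2) by (simp only: ring_distribs power2_eq_square mult_ac)
        then have "(f (?p z) - f (?q z)) / ?h z \<le> W (?q z) (y (?p z) + ?h z) + K * ?h z"
          using \<open>?p z < ?q z\<close> by (subst pos_divide_le_eq) auto
        moreover have "z \<noteq> x" using elim(1) by auto
        ultimately show ?case unfolding quot[OF \<open>z \<noteq> x\<close>] neg_le_iff_le by blast
      qed
      show "\<forall>\<^sub>F z in at x. (f z - f x) / (z - x) \<le> - W (?q z) (y (?p z) - ?h z)"
        using ev_ab ev_region[OF ylo]
      proof eventually_elim
        case (elim z)
        then have "?p z < ?q z" "a \<le> ?p z" "?q z \<le> b" using x by (auto simp: min_def max_def)
        from bounds(1)[OF this(2,1,3)]
        have "W (?q z) (y (?p z) - ?h z) * ?h z \<le> f (?p z) - f (?q z)"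
          unfolding elim(2) by (simp only: mult_ac)
        then have "W (?q z) (y (?p z) - ?h z) \<le> (f (?p z) - f (?q z)) / ?h z"
          using \<open>?p z < ?q z\<close> by (subst pos_le_divide_eq) auto
        moreover have "z \<noteq> x" using elim(1) by auto
        ultimately show ?case unfolding quot[OF \<open>z \<noteq> x\<close>] neg_le_iff_le by blast
      qed
    qed
    then show ?thesis by (simp add: has_field_derivative_iff)
  qed
  have V_cont: "continuous_on {a..b} V"
    using V by (meson DERIV_isCont continuous_at_imp_continuous_on)
  \<comment> \<open>In the open interval both functions have derivative \<open>- W\<close>;
    continuity at the endpoints carries the agreement at \<open>b\<close> back to
    \<open>a\<close>.\<close>
  have "f b - V b = f a - V a"
  proof (rule DERIV_isconst_end[OF \<open>a < b\<close>])
    show "continuous_on {a..b} (\<lambda>s. f s - V s)"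
      by (intro continuous_intros f_cont V_cont)
    fix x assume "a < x" "x < b"
    then show "((\<lambda>s. f s - V s) has_real_derivative 0) (at x)"
      using DERIV_diff[OF f_deriv V[of x]] by (simp add: y_def)
  qed
  moreover have "f b = V b"
    unfolding f_def P_def y_def V_end scale using rate_pos by simp
  ultimately have "f a = V a" by simp
  from unscale[OF this[unfolded f_def P_def y_def]] show ?thesis
    using rate_pos by (simp add: exp_minus)
qed

end

subsection \<open>The closed form\<close>

text \<open>The probability that a simple symmetric random walk is at its starting point after
  \<open>2 * j\<close> steps.\<close>

definition central_weight :: "nat \<Rightarrow> real" where
  "central_weight j = real ((2 * j) choose j) / 4 ^ j"

text \<open>A division-free form of the sum in the theorem: the sum over \<open>j < k\<close> of
  \<open>t ^ (2 * (k - 1 - j)) * central_weight j * (t\<^sup>2 - y\<^sup>2) ^ j\<close>. The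
  recursion suits the inductions for the derivatives.\<close>

primrec weight_poly :: "nat \<Rightarrow> real \<Rightarrow> real \<Rightarrow> real" where
  "weight_poly 0 t y = 0"
| "weight_poly (Suc k) t y = t\<^sup>2 * weight_poly k t y + central_weight k * (t\<^sup>2 - y\<^sup>2) ^ k"

text \<open>
  \<open>down_volume k t y\<close> is the volume of the set of \<open>2 * k\<close> ordered jump times in \<open>[0, t]\<close> for
  which a particle starting downwards stays below \<open>y\<close>, and \<open>up_volume k t y\<close> is that of
  \<open>2 * k + 1\<close> jump times and an upward start; both only for \<open>0 < y < t\<close>.
\<close>

definition down_volume :: "nat \<Rightarrow> real \<Rightarrow> real \<Rightarrow> real" where
  "down_volume k t y = (y * t * weight_poly k t y + central_weight k * (t\<^sup>2 - y\<^sup>2) ^ k) / fact (2 * k)"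

definition up_volume :: "nat \<Rightarrow> real \<Rightarrow> real \<Rightarrow> real" where
  "up_volume k t y = y * weight_poly (Suc k) t y / fact (2 * k + 1)"

section \<open>Algebra and derivatives of the polynomial volumes\<close>

lemma central_weight_0 [simp]: "central_weight 0 = 1"
  by (simp add: central_weight_def)

lemma central_weight_Suc:
  "central_weight (Suc k) = (2 * real k + 1) / (2 * real k + 2) * central_weight k"
proof -
  have *: "real ((2 * j) choose j) = fact (2 * j) / (fact j * fact j)" for j :: nat
    using binomial_fact[of j "2 * j", where ?'a = real] by (simp add: mult_2)
  have f2: "(fact (2 * Suc k) :: real) = 2 * (real k + 1) * (2 * real k + 1) * fact (2 * k)"
    by (simp add: algebra_simps)
  have f1: "(fact (Suc k) :: real) = (real k + 1) * fact k"
    by simp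
  have cancel: "2 * K * m * F / ((K * f) * (K * f)) / (4 * q) = m / (2 * K) * (F / (f * f) / q)"
    if "K \<noteq> 0" for K m F f q :: real
    using that by (simp add: field_simps)
  have "2 * real k + 2 = 2 * (real k + 1)" by simp
  then show ?thesis
    unfolding central_weight_def * f2 f1 power_Suc by (simp only:) (rule cancel, simp)
qed

text \<open>The factor \<open>t\<^sup>2\<close> on the left avoids the exponent
  \<open>2 * k - 2\<close>.\<close>

lemma weight_poly_eq_sum:
  assumes "t \<noteq> 0"
  shows "t\<^sup>2 * weight_poly k t y = t ^ (2 * k) * (\<Sum>j<k. ((t\<^sup>2 - y\<^sup>2) / t\<^sup>2) ^ j * central_weight j)"
proof (induction k)
  case (Suc k)
  let ?S = "\<Sum>j<k. ((t\<^sup>2 - y\<^sup>2) / t\<^sup>2) ^ j * central_weight j"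
  have p: "t ^ (2 * k) * ((t\<^sup>2 - y\<^sup>2) / t\<^sup>2) ^ k = (t\<^sup>2 - y\<^sup>2) ^ k"
    using assms by (simp add: power_mult power_divide)
  have "t\<^sup>2 * weight_poly (Suc k) t y =
      t\<^sup>2 * (t ^ (2 * k) * ?S) + t\<^sup>2 * (central_weight k * (t ^ (2 * k) * ((t\<^sup>2 - y\<^sup>2) / t\<^sup>2) ^ k))"
    unfolding p Suc[symmetric] by (simp add: distrib_left)
  also have "\<dots> = (t\<^sup>2 * t ^ (2 * k)) * (?S + ((t\<^sup>2 - y\<^sup>2) / t\<^sup>2) ^ k * central_weight k)"
    by (simp only: distrib_left mult_ac)
  also have "t\<^sup>2 * t ^ (2 * k) = t ^ (2 * Suc k)"
    by (simp add: power2_eq_square)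
  finally show ?case by simp
qed simp

text \<open>Only the term for \<open>j = 0\<close> survives at \<open>y = t\<close>; this supplies
  the boundary value for downward starts.\<close>

lemma weight_poly_diagonal: "weight_poly (Suc k) t t = t ^ (2 * k)"
  by (induction k) (simp_all add: power2_eq_square mult_ac)

lemma weight_poly_isCont: "isCont (\<lambda>x. weight_poly k (f x) (g x)) x"
  if "isCont f x" "isCont g x" for f g :: "'b::t2_space \<Rightarrow> real"
  using that by (induction k) (auto intro!: continuous_intros)

text \<open>Here \<open>\<tau>\<close> is the remaining time and \<open>\<eta>\<close> the distance
  to the barrier; on an upward run both decrease at unit rate. The induction closes by the ratio of
  consecutive central weights.\<close>

lemma DERIV_weight_poly_up:
  assumes "(\<tau> has_real_derivative - 1) (at s)" "(\<eta> has_real_derivative - 1) (at s)"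
  shows "((\<lambda>s. \<eta> s * weight_poly (Suc k) (\<tau> s) (\<eta> s)) has_real_derivative
    - (2 * real k + 1) * (\<eta> s * \<tau> s * weight_poly k (\<tau> s) (\<eta> s)
      + central_weight k * ((\<tau> s)\<^sup>2 - (\<eta> s)\<^sup>2) ^ k)) (at s)"
proof (induction k)
  case 0
  then show ?case using assms by simp
next
  case (Suc k)
  let ?w = "(\<tau> s)\<^sup>2 - (\<eta> s)\<^sup>2"
  have eq: "(\<lambda>s. \<eta> s * weight_poly (Suc (Suc k)) (\<tau> s) (\<eta> s)) =
    (\<lambda>s. (\<tau> s)\<^sup>2 * (\<eta> s * weight_poly (Suc k) (\<tau> s) (\<eta> s))
      + central_weight (Suc k) * (\<eta> s * ((\<tau> s)\<^sup>2 - (\<eta> s)\<^sup>2) ^ Suc k))"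
    by (simp only: weight_poly.simps(2)[of "Suc k"] distrib_left mult_ac)
  have w: "((\<lambda>s. \<eta> s * ((\<tau> s)\<^sup>2 - (\<eta> s)\<^sup>2) ^ Suc k) has_real_derivative
      - (?w ^ Suc k) + \<eta> s * (real (Suc k) * ?w ^ k * (- 2 * \<tau> s + 2 * \<eta> s))) (at s)"
    using assms by (auto intro!: derivative_eq_intros simp del: power_Suc)
  have t2: "((\<lambda>s. (\<tau> s)\<^sup>2) has_real_derivative - 2 * \<tau> s) (at s)"
    using assms(1) by (auto intro!: derivative_eq_intros)
  note D = DERIV_add[OF DERIV_mult[OF t2 Suc.IH] DERIV_cmult[OF w, of "central_weight (Suc k)"]]
  show ?case
    unfolding eq
    by (rule DERIV_cong[OF D]) (simp add: central_weight_Suc field_simps power2_eq_square)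
qed

text \<open>On a downward run the distance grows while the remaining time shrinks, so
  \<open>\<tau> + \<eta>\<close> is constant.\<close>

lemma DERIV_weight_poly_down:
  assumes "(\<tau> has_real_derivative - 1) (at s)" "(\<eta> has_real_derivative 1) (at s)"
  shows "((\<lambda>s. \<eta> s * \<tau> s * weight_poly (Suc k) (\<tau> s) (\<eta> s)
      + central_weight (Suc k) * ((\<tau> s)\<^sup>2 - (\<eta> s)\<^sup>2) ^ Suc k) has_real_derivative
    - (2 * real k + 2) * (\<eta> s * weight_poly (Suc k) (\<tau> s) (\<eta> s))) (at s)"
proof (induction k)
  case 0
  then show ?case using assms
    by (auto simp: central_weight_Suc field_simps intro!: derivative_eq_intros)
next
  case (Suc k)
  let ?R = "\<lambda>k s. \<eta> s * \<tau> s * weight_poly k (\<tau> s) (\<eta> s) + central_weight k * ((\<tau> s)\<^sup>2 - (\<eta> s)\<^sup>2) ^ k"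
  let ?w = "(\<tau> s)\<^sup>2 - (\<eta> s)\<^sup>2"
  \<comment> \<open>Splitting off \<open>\<tau>\<^sup>2\<close> times the previous stage exposes the
    induction hypothesis; the factor \<open>\<eta> s - \<tau> s\<close> is left over because the
    central term of that stage is also multiplied by \<open>\<tau>\<^sup>2\<close>.\<close>
  have eq: "?R (Suc (Suc k)) = (\<lambda>s. (\<tau> s)\<^sup>2 * ?R (Suc k) s
      + (central_weight (Suc k) * ((\<tau> s * (\<eta> s - \<tau> s)) * ((\<tau> s)\<^sup>2 - (\<eta> s)\<^sup>2) ^ Suc k)
      + central_weight (Suc (Suc k)) * ((\<tau> s)\<^sup>2 - (\<eta> s)\<^sup>2) ^ Suc (Suc k)))"
    unfolding weight_poly.simps(2)[of "Suc k"] by (intro ext) (simp add: algebra_simps power2_eq_square del: power_Suc weight_poly.simps)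
  have w: "((\<lambda>s. (\<tau> s * (\<eta> s - \<tau> s)) * ((\<tau> s)\<^sup>2 - (\<eta> s)\<^sup>2) ^ Suc k) has_real_derivative
      (- (\<eta> s - \<tau> s) + 2 * \<tau> s) * ?w ^ Suc k
      + (\<tau> s * (\<eta> s - \<tau> s)) * (real (Suc k) * ?w ^ k * (- 2 * \<tau> s - 2 * \<eta> s))) (at s)"
    using assms by (auto intro!: derivative_eq_intros simp del: power_Suc)
  have w': "((\<lambda>s. ((\<tau> s)\<^sup>2 - (\<eta> s)\<^sup>2) ^ Suc (Suc k)) has_real_derivative
      (real (Suc (Suc k)) * ?w ^ Suc k * (- 2 * \<tau> s - 2 * \<eta> s))) (at s)"
    using assms by (auto intro!: derivative_eq_intros simp del: power_Suc)
  have t2: "((\<lambda>s. (\<tau> s)\<^sup>2) has_real_derivative - 2 * \<tau> s) (at s)"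
    using assms(1) by (auto intro!: derivative_eq_intros)
  note D = DERIV_add[OF DERIV_mult[OF t2 Suc.IH] DERIV_add[OF DERIV_cmult[OF w, of "central_weight (Suc k)"]
     DERIV_cmult[OF w', of "central_weight (Suc (Suc k))"]]]
  have c: "central_weight (Suc (Suc k)) = (2 * real k + 3) / (2 * real k + 4) * central_weight (Suc k)"
    by (subst central_weight_Suc) (simp add: add_ac)
  show ?case
    unfolding eq
    by (rule DERIV_cong[OF D]) (simp add: c field_simps power2_eq_square)
qed

lemma up_volume_isCont: "isCont (\<lambda>(s, y). up_volume k (t - s) y) (x, y)"
  unfolding up_volume_def case_prod_unfold
  by (intro continuous_intros weight_poly_isCont) auto

lemma down_volume_isCont: "isCont (\<lambda>(s, y). down_volume k (t - s) y) (x, y)"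
  unfolding down_volume_def case_prod_unfold
  by (intro continuous_intros weight_poly_isCont) auto

lemma DERIV_up_volume:
  assumes "(\<tau> has_real_derivative - 1) (at s)" "(\<eta> has_real_derivative - 1) (at s)"
  shows "((\<lambda>s. up_volume k (\<tau> s) (\<eta> s)) has_real_derivative - down_volume k (\<tau> s) (\<eta> s)) (at s)"
proof -
  have cancel: "- a * z / (a * f) = - (z / f)" if "a \<noteq> 0" for a z f :: real
    using that by simp
  have "(2 * real k + 1) \<noteq> 0" using of_nat_0_le_iff[of k, where 'a = real] by linarith
  then have "- (2 * real k + 1) * z / ((2 * real k + 1) * fact (2 * k)) = - (z / fact (2 * k))" for z
    by (rule cancel)
  moreover have "(2 * real k + 1) * fact (2 * k) = fact (2 * k + 1)" by (simp add: add_ac)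
  ultimately have "- (2 * real k + 1) * z / fact (2 * k + 1) = - (z / fact (2 * k))" for z
    by (simp only:)
  then show ?thesis
    unfolding up_volume_def down_volume_def
    by (rule DERIV_cong[OF DERIV_cdivide[OF DERIV_weight_poly_up[OF assms]]])
qed

lemma DERIV_down_volume:
  assumes "(\<tau> has_real_derivative - 1) (at s)" "(\<eta> has_real_derivative 1) (at s)"
  shows "((\<lambda>s. down_volume (Suc k) (\<tau> s) (\<eta> s)) has_real_derivative - up_volume k (\<tau> s) (\<eta> s)) (at s)"
proof -
  have cancel: "- a * z / (a * f) = - (z / f)" if "a \<noteq> 0" for a z f :: real
    using that by simp
  have "(2 * real k + 2) \<noteq> 0" using of_nat_0_le_iff[of k, where 'a = real] by linarith
  then have "- (2 * real k + 2) * z / ((2 * real k + 2) * fact (2 * k + 1)) = - (z / fact (2 * k + 1))" for z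
    by (rule cancel)
  moreover have "(2 * real k + 2) * fact (2 * k + 1) = fact (2 * Suc k)" by (simp add: add_ac)
  ultimately have "- (2 * real k + 2) * z / fact (2 * Suc k) = - (z / fact (2 * k + 1))" for z
    by (simp only:)
  then show ?thesis
    unfolding up_volume_def down_volume_def
    by (rule DERIV_cong[OF DERIV_cdivide[OF DERIV_weight_poly_down[OF assms]]])
qed

section \<open>Boundary values and solution of the transport equations\<close>

context poisson_process
begin

text \<open>
  The right-continuity of the path makes this exact also for \<open>y = t - s\<close>, which is where
  the downward characteristics leave the region \<open>y < t - s\<close>.
\<close>

lemma survival_prob_down_high:
  assumes "0 \<le> s" "s < t" "t - s \<le> y"
  shows "survival_prob t (- 1) n s y = exp (- (rate * (t - s))) * (rate * (t - s)) ^ n / fact n"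
proof -
  have "survival (\<lambda>u. N u \<omega>) t (- 1) n s y \<longleftrightarrow> N t \<omega> - N s \<omega> = n" if \<omega>: "\<omega> \<in> space M" for \<omega>
  proof -
    note path = jump_path_sample[OF \<omega>]
    have "- 1 * displacement (\<lambda>u. N u \<omega>) s u < y" if "u \<in> {s..t}" for u
      using displacement_gt[OF path assms(1), of u] that assms by (cases "u = s") auto
    then show ?thesis
      using mono_path[OF \<omega>, of s t] assms by (auto simp: survival_def)
  qed
  then have "{\<omega> \<in> space M. survival (\<lambda>u. N u \<omega>) t (- 1) n s y} = {\<omega> \<in> space M. N t \<omega> - N s \<omega> = n}"
    by blast
  then show ?thesis
    using prob_increment[OF assms(1,2)] by (simp add: survival_prob_def)
qed

text \<open>Without jumps the particle only descends. This starts the induction.\<close>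

lemma survival_prob_down_0:
  assumes "0 \<le> s" "s < t" "0 < y"
  shows "survival_prob t (- 1) 0 s y = exp (- (rate * (t - s)))"
proof -
  have "survival (\<lambda>u. N u \<omega>) t (- 1) 0 s y \<longleftrightarrow> N t \<omega> - N s \<omega> = 0" if \<omega>: "\<omega> \<in> space M" for \<omega>
  proof
    assume "N t \<omega> - N s \<omega> = 0"
    then have eq: "N t \<omega> = N s \<omega>" using mono_path[OF \<omega>, of s t] assms by simp
    have "- 1 * displacement (\<lambda>u. N u \<omega>) s u < y" if "u \<in> {s..t}" for u
      using displacement_constant[OF jump_path_sample[OF \<omega>] assms(1), of u] mono_path[OF \<omega>, of s u]
        mono_path[OF \<omega>, of u t] that assms eq by auto
    then show "survival (\<lambda>u. N u \<omega>) t (- 1) 0 s y" using eq by (auto simp: survival_def)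
  qed (simp add: survival_def)
  then have "{\<omega> \<in> space M. survival (\<lambda>u. N u \<omega>) t (- 1) 0 s y} = {\<omega> \<in> space M. N t \<omega> - N s \<omega> = 0}"
    by blast
  then show ?thesis
    using prob_increment[OF assms(1,2), of 0] by (simp add: survival_prob_def)
qed

text \<open>Survival already fails at \<open>u = s\<close>, where the displacement is
  \<open>0\<close>. This is the boundary value for upward starts.\<close>

lemma survival_prob_nonpos:
  assumes "s \<le> t" "y \<le> 0"
  shows "survival_prob t sg n s y = 0"
proof -
  have "{\<omega> \<in> space M. survival (\<lambda>u. N u \<omega>) t sg n s y} = {}"
    using assms by (force simp: survival_def)
  then show ?thesis by (simp only: survival_prob_def measure_empty)
qed

text \<open>The two formulas are proved alternately: downward with \<open>2 * k\<close> jumps is the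
  source for upward with \<open>2 * k + 1\<close>, and this in turn for downward with
  \<open>2 * k + 2\<close>.\<close>

lemma survival_prob_eq:
  assumes "0 \<le> s" "0 < y" "y < t - s"
  shows "survival_prob t (- 1) (2 * k) s y = exp (- (rate * (t - s))) * rate ^ (2 * k) * down_volume k (t - s) y"
      (is "?down k s y")
    and "survival_prob t 1 (2 * k + 1) s y = exp (- (rate * (t - s))) * rate ^ (2 * k + 1) * up_volume k (t - s) y"
      (is "?up k s y")
proof -
  have up: "?up k s y" if down: "\<And>s y. 0 \<le> s \<Longrightarrow> 0 < y \<Longrightarrow> y < t - s \<Longrightarrow> ?down k s y"
    and sy: "0 \<le> s" "0 < y" "y < t - s" for k s y
  proof -
    have "survival_prob t 1 (Suc (2 * k)) s y =
        exp (- (rate * (t - s))) * rate ^ Suc (2 * k) * up_volume k (t - s) (y - (s - s))"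
    \<comment> \<open>At time \<open>s + y\<close> a straight upward run reaches the barrier, where
      both sides vanish.\<close>
    proof (rule survival_prob_along_characteristic[where b="s + y" and W="\<lambda>s y. down_volume k (t - s) y"
          and V="\<lambda>x. up_volume k (t - x) (y - (x - s))"])
      show "((\<lambda>x. up_volume k (t - x) (y - (x - s))) has_real_derivative
          - down_volume k (t - x) (y - 1 * (x - s))) (at x)" for x
        unfolding mult_1_left by (rule DERIV_up_volume) (auto intro!: derivative_eq_intros)
      show "survival_prob t 1 (Suc (2 * k)) (s + y) (y - 1 * (s + y - s)) =
          exp (- (rate * (t - (s + y)))) * rate ^ Suc (2 * k) * up_volume k (t - (s + y)) (y - (s + y - s))"
        using sy by (simp add: survival_prob_nonpos up_volume_def)
    qed (use sy down down_volume_isCont in auto)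
    then show ?thesis by simp
  qed
  have down: "?down k s y" if "0 \<le> s" "0 < y" "y < t - s" for s y
    using that
  proof (induction k arbitrary: s y)
    case 0
    then show ?case by (simp add: survival_prob_down_0 down_volume_def)
  next
    case (Suc k)
    \<comment> \<open>The time at which the distance on a straight downward run equals the remaining
      time; from then on the barrier is out of reach.\<close>
    define b where "b = s + (t - s - y) / 2"
    have b: "s < b" "b < t" "y + (b - s) = t - b"
      using Suc.prems by (auto simp: b_def field_simps)
    have "survival_prob t (- 1) (Suc (2 * k + 1)) s y =
        exp (- (rate * (t - s))) * rate ^ Suc (2 * k + 1) * down_volume (Suc k) (t - s) (y + (s - s))"
    proof (rule survival_prob_along_characteristic[where b=b and W="\<lambda>s y. up_volume k (t - s) y"
          and V="\<lambda>x. down_volume (Suc k) (t - x) (y + (x - s))"])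
      show "((\<lambda>x. down_volume (Suc k) (t - x) (y + (x - s))) has_real_derivative
          - up_volume k (t - x) (y - - 1 * (x - s))) (at x)" for x
      proof -
        have *: "y - - 1 * (x - s) = y + (x - s)" by simp
        show ?thesis unfolding * by (rule DERIV_down_volume) (auto intro!: derivative_eq_intros)
      qed
      have y_b: "y - - 1 * (b - s) = t - b" using b by simp
      have "down_volume (Suc k) (t - b) (t - b) = (t - b) ^ (2 * Suc k) / fact (2 * Suc k)"
        unfolding down_volume_def weight_poly_diagonal by (simp add: power2_eq_square)
      then show "survival_prob t (- 1) (Suc (2 * k + 1)) b (y - - 1 * (b - s)) =
          exp (- (rate * (t - b))) * rate ^ Suc (2 * k + 1) * down_volume (Suc k) (t - b) (y + (b - s))"
        unfolding y_b b(3) using Suc.prems b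
        by (simp add: survival_prob_down_high power_mult_distrib del: fact_Suc power_Suc)
      show "survival_prob t (- (- 1)) (2 * k + 1) s' y' =
          exp (- (rate * (t - s'))) * rate ^ (2 * k + 1) * up_volume k (t - s') y'"
        if "0 \<le> s'" "0 < y'" "y' < t - s'" for s' y'
        using up[OF Suc.IH that] by simp
      show "y - - 1 * (x - s) < t - x" if "x < b" for x
        using that b by simp
    qed (use Suc.prems b up_volume_isCont in auto)
    then show ?case by simp
  qed
  show "?down k s y" by (rule down) fact+
  show "?up k s y" by (rule up[OF down]) (use assms in auto)
qed

end

section \<open>From the telegraph process to the survival probabilities\<close>

theorem corollary5p2:
  fixes M :: "'a measure" and V0 :: "'a \<Rightarrow> real" and N :: "real \<Rightarrow> 'a \<Rightarrow> nat"
    and c rate t \<beta> :: real and k :: nat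
  assumes "symmetric_telegraph M rate N c V0"
    and "0 < t" and "1 \<le> k" and "0 < \<beta>" and "\<beta> < c * t"
  shows "\<P>(\<omega> in M. telegraph_max V0 N t \<omega> < \<beta> \<bar> V0 \<omega> = - c \<and> N t \<omega> = 2 * k) =
    \<beta> / (c * t) * (\<Sum>j = 0..k - 1.
        ((c\<^sup>2 * t\<^sup>2 - \<beta>\<^sup>2) / (c\<^sup>2 * t\<^sup>2)) ^ j * (1 / 2 ^ (2 * j)) * real ((2 * j) choose j))
      + (c\<^sup>2 * t\<^sup>2 - \<beta>\<^sup>2) ^ k / (2 * c * t) ^ (2 * k) * real ((2 * k) choose k)"
proof -
  interpret symmetric_telegraph M rate N c V0 by fact
  note path = jump_path_sample
  define b where "b = \<beta> / c"
  have b: "0 < b" "b < t" and \<beta>: "\<beta> = c * b"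
    using assms(2-) speed_pos by (auto simp: b_def field_simps)
  let ?V = "{\<omega> \<in> space M. V0 \<omega> = - c}"
  let ?S = "\<lambda>\<omega>. survival (\<lambda>u. N u \<omega>) t (- 1) (2 * k) 0 b"
  let ?n = "\<lambda>\<omega>. N t \<omega> = 2 * k"
  have max_iff: "telegraph_max V0 N t \<omega> < \<beta> \<longleftrightarrow> (\<forall>u\<in>{0..t}. - 1 * displacement (\<lambda>u. N u \<omega>) 0 u < b)"
    if \<omega>: "\<omega> \<in> space M" "V0 \<omega> = - c" for \<omega>
  proof -
    have tel: "telegraph V0 N s \<omega> = - c * displacement (\<lambda>u. N u \<omega>) 0 s" for s
      using start_zero[OF \<omega>(1)] \<omega>(2) by (simp add: telegraph_def displacement_def)
    have cont: "continuous_on {0..t} (\<lambda>s. telegraph V0 N s \<omega>)"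
      unfolding tel by (intro continuous_intros continuous_on_displacement path \<omega>) simp
    obtain x where x: "x \<in> {0..t}" "\<And>s. s \<in> {0..t} \<Longrightarrow> telegraph V0 N s \<omega> \<le> telegraph V0 N x \<omega>"
      using continuous_attains_sup[OF _ _ cont] assms(2) by force
    \<comment> \<open>The supremum is attained, so bounding it strictly is the same as bounding
      every value strictly.\<close>
    have "telegraph_max V0 N t \<omega> = telegraph V0 N x \<omega>"
      unfolding telegraph_max_def using x by (intro cSup_eq_maximum) auto
    then have "telegraph_max V0 N t \<omega> < \<beta> \<longleftrightarrow> (\<forall>s\<in>{0..t}. telegraph V0 N s \<omega> < \<beta>)"
      using x by force
    also have "\<dots> \<longleftrightarrow> (\<forall>s\<in>{0..t}. - 1 * displacement (\<lambda>u. N u \<omega>) 0 s < b)"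
    proof (rule ball_cong[OF refl])
      fix s
      have "- c * e < c * b \<longleftrightarrow> - 1 * e < b" for e
        using speed_pos mult_less_cancel_left_pos[of c "- e" b] by simp
      then show "telegraph V0 N s \<omega> < \<beta> \<longleftrightarrow> - 1 * displacement (\<lambda>u. N u \<omega>) 0 s < b"
        unfolding tel \<beta> .
    qed
    finally show ?thesis .
  qed
  have S_iff: "?S \<omega> \<longleftrightarrow> (\<forall>u\<in>{0..t}. - 1 * displacement (\<lambda>u. N u \<omega>) 0 u < b) \<and> ?n \<omega>" if "\<omega> \<in> space M" for \<omega>
    using start_zero[OF that] by (simp add: survival_def)
  let ?X = "\<lambda>\<omega>. \<lambda>t\<in>{0..}. N t \<omega>"
  let ?Pi = "PiM {0..} (\<lambda>_. count_space (UNIV :: nat set)) :: (real \<Rightarrow> nat) measure"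
  \<comment> \<open>The sigma-algebra generated by the whole counting path. The assumed independence
    of \<open>V0\<close> concerns exactly its sets, so the survival event has to be located in
    it.\<close>
  let ?G = "vimage_algebra (space M) ?X ?Pi"
  have X_space: "?X \<in> space M \<rightarrow> space ?Pi" by (auto simp: space_PiM)
  have X_meas: "N u \<in> measurable ?G (count_space UNIV)" if "0 \<le> u" for u
  proof -
    have "(\<lambda>\<omega>. ?X \<omega> u) \<in> measurable ?G (count_space UNIV)"
      using that by (intro measurable_compose[OF measurable_vimage_algebra1[OF X_space]]
          measurable_component_singleton) auto
    then show ?thesis using that by simp
  qed
  have indep: "prob (?V \<inter> {\<omega> \<in> space M. P \<omega>}) = 1 / 2 * prob {\<omega> \<in> space M. P \<omega>}"
    if "{\<omega> \<in> space ?G. P \<omega>} \<in> sets ?G" for P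
  proof -
    have "{\<omega> \<in> space M. P \<omega>} \<in> {?X -` B \<inter> space M | B. B \<in> sets ?Pi}"
      using that unfolding sets_vimage_algebra2[OF X_space] by simp
    moreover have "?V \<in> {V0 -` A \<inter> space M | A. A \<in> sets borel}"
      by (intro CollectI exI[of _ "{- c}"]) auto
    ultimately show ?thesis
      using indep_setD[OF indep_V0_N] prob_V0_neg by simp
  qed
  have S_prob: "prob (?V \<inter> {\<omega> \<in> space M. ?S \<omega>}) = 1 / 2 * survival_prob t (- 1) (2 * k) 0 b"
    unfolding survival_prob_def
  proof (rule indep, rule survival_sets)
    fix u :: real assume u: "0 \<le> u"
    show "(\<lambda>\<omega>. N u \<omega> - N 0 \<omega>) \<in> measurable ?G (count_space UNIV)"
      by (rule measurable_cong[THEN iffD2, OF _ X_meas[OF u]]) (simp add: start_zero)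
  qed (use assms(2) path in auto)
  have n_prob: "prob (?V \<inter> {\<omega> \<in> space M. ?n \<omega>}) =
      1 / 2 * (exp (- (rate * t)) * (rate * t) ^ (2 * k) / fact (2 * k))"
  proof -
    have "{\<omega> \<in> space ?G. ?n \<omega>} \<in> sets ?G"
      using measurable_sets[OF X_meas[of t], of "{2 * k}"] assms(2)
      by (simp add: vimage_def Int_def conj_commute)
    moreover have "{\<omega> \<in> space M. ?n \<omega>} = {\<omega> \<in> space M. N t \<omega> - N 0 \<omega> = 2 * k}"
      using start_zero by auto
    ultimately show ?thesis
      using indep[of ?n] prob_increment[of 0 t "2 * k"] assms(2) by simp
  qed
  have "\<P>(\<omega> in M. telegraph_max V0 N t \<omega> < \<beta> \<bar> V0 \<omega> = - c \<and> ?n \<omega>) =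
      prob (?V \<inter> {\<omega> \<in> space M. ?S \<omega>}) / prob (?V \<inter> {\<omega> \<in> space M. ?n \<omega>})"
    unfolding cond_prob_def using max_iff S_iff
    by (intro arg_cong2[where f="(/)"] arg_cong[where f=prob]) blast+
  \<comment> \<open>The factors \<open>1 / 2\<close>, \<open>exp (- (rate * t))\<close> and
    \<open>rate ^ (2 * k)\<close> cancel, leaving the ratio to the full volume
    \<open>t ^ (2 * k) / fact (2 * k)\<close>.\<close>
  also have "\<dots> = down_volume k t b * fact (2 * k) / t ^ (2 * k)"
    using survival_prob_eq(1)[of 0 b t k] b rate_pos assms(2)
    unfolding S_prob n_prob by (simp add: power_mult_distrib field_simps)
  also have "\<dots> = b * t * weight_poly k t b / t ^ (2 * k) + central_weight k * (t\<^sup>2 - b\<^sup>2) ^ k / t ^ (2 * k)"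
    unfolding down_volume_def by (simp flip: add_divide_distrib)
  also have "b * t * weight_poly k t b / t ^ (2 * k) =
      b / t * (\<Sum>j<k. ((t\<^sup>2 - b\<^sup>2) / t\<^sup>2) ^ j * central_weight j)"
  proof -
    have "b * t * weight_poly k t b = b / t * (t\<^sup>2 * weight_poly k t b)"
      using assms(2) by (simp add: power2_eq_square)
    then show ?thesis
      unfolding weight_poly_eq_sum[OF less_imp_neq[OF assms(2), symmetric]] using assms(2) by simp
  qed
  also have "(\<Sum>j<k. ((t\<^sup>2 - b\<^sup>2) / t\<^sup>2) ^ j * central_weight j) =
      (\<Sum>j = 0..k - 1. ((c\<^sup>2 * t\<^sup>2 - \<beta>\<^sup>2) / (c\<^sup>2 * t\<^sup>2)) ^ j * (1 / 2 ^ (2 * j)) * real ((2 * j) choose j))"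
  proof (rule sum.cong)
    \<comment> \<open>For \<open>k = 0\<close> truncated subtraction would leave the index
      \<open>0\<close> on the right; \<open>1 \<le> k\<close> excludes this.\<close>
    show "{..<k} = {0..k - 1}" using assms(3) by auto
    have "(c\<^sup>2 * t\<^sup>2 - \<beta>\<^sup>2) / (c\<^sup>2 * t\<^sup>2) = (t\<^sup>2 - b\<^sup>2) / t\<^sup>2"
      using speed_pos by (simp add: \<beta> power_mult_distrib right_diff_distrib[symmetric])
    then show "((t\<^sup>2 - b\<^sup>2) / t\<^sup>2) ^ j * central_weight j =
      ((c\<^sup>2 * t\<^sup>2 - \<beta>\<^sup>2) / (c\<^sup>2 * t\<^sup>2)) ^ j * (1 / 2 ^ (2 * j)) * real ((2 * j) choose j)" for j
      by (simp add: central_weight_def power_mult)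
  qed
  also have "b / t = \<beta> / (c * t)" using speed_pos by (simp add: \<beta>)
  also have "central_weight k * (t\<^sup>2 - b\<^sup>2) ^ k / t ^ (2 * k) =
      (c\<^sup>2 * t\<^sup>2 - \<beta>\<^sup>2) ^ k / (2 * c * t) ^ (2 * k) * real ((2 * k) choose k)"
  proof -
    have num: "c\<^sup>2 * t\<^sup>2 - \<beta>\<^sup>2 = c\<^sup>2 * (t\<^sup>2 - b\<^sup>2)"
      by (simp add: \<beta> power_mult_distrib right_diff_distrib)
    have den: "(2 * c * t) ^ (2 * k) = 4 ^ k * (c\<^sup>2) ^ k * t ^ (2 * k)"
      by (simp add: power_mult power_mult_distrib)
    show ?thesis
      unfolding num den using speed_pos by (simp add: central_weight_def power_mult_distrib)
  qed
  finally show ?thesis .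
qed

end
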